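(* For every integer $n\geq 1$, $$\sum_{\sigma\in \mathfrak{S}_n}(-1/q)^{\operatorname{exc} \sigma } q^{\operatorname{inv} \sigma} =\begin{cases} 0&\text{if $n$ is even},\\ (-1)^{\frac{n-1}{2}} \sum_{\sigma\in \mathfrak{A}_{n}} q^{ (31\text{-}2)\sigma + 2\,(2\text{-}13)\sigma}&\text{if $n$ is odd}; \end{cases}$$ and $$\sum_{\sigma\in \mathfrak{D}_n}(-1)^{\operatorname{exc} \sigma}q^{\operatorname{inv}\sigma} =\begin{cases} (-q)^{\frac{n}{2}} \sum_{\sigma\in \mathfrak{A}_{n}} q^{ (31\text{-}2)\sigma + 2\,(2\text{-}31)\sigma} &\text{if $n$ is even},\\ 0 &\text{if $n$ is odd}. \end{cases}$$
   Context: $\mathfrak{S}_n$ is the set of permutations $\sigma=\sigma_1\sigma_2\cdots\sigma_n$ of $[n]=\{1,\dots,n\}$, and $\mathfrak{D}_n\subseteq\mathfrak{S}_n$ is the set of derangements (permutations with no $i$ such that $\sigma_i=i$). $\mathfrak{A}_n$ is the set of falling alternating permutations in $\mathfrak{S}_n$, i.e. those with $\sigma_1>\sigma_2<\sigma_3>\sigma_4<\cdots$. For $\sigma\in\mathfrak{S}_n$: $\operatorname{exc}\sigma=\#\{i\in[n]:\sigma_i>i\}$; $\operatorname{inv}\sigma=\#\{(i,j):1\le i<j\le n,\ \sigma_i>\sigma_j\}$; $(31\text{-}2)\sigma=\#\{(i,j): i+1<j,\ \sigma_i>\sigma_j>\sigma_{i+1}\}$; $(2\text{-}31)\sigma=\#\{(i,j):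 j<i-1,\ \sigma_{i-1}>\sigma_j>\sigma_i\}$; $(2\text{-}13)\sigma=\#\{(i,j): j<i-1,\ \sigma_{i-1}<\sigma_j<\sigma_i\}$. *)

theory Defs
  imports "HOL-Combinatorics.Permutations"
begin

definition perms :: "nat \<Rightarrow> (nat \<Rightarrow> nat) set" where
  "perms n = {s. s permutes {1..n}}"

definition derangements :: "nat \<Rightarrow> (nat \<Rightarrow> nat) set" where
  "derangements n = {s \<in> perms n. \<forall>i\<in>{1..n}. s i \<noteq> i}"

definition falt :: "nat \<Rightarrow> (nat \<Rightarrow> nat) set" where
  "falt n = {s \<in> perms n. \<forall>i. 1 \<le> i \<and> i < n \<longrightarrow>
              (if odd i then s i > s (Suc i) else s i < s (Suc i))}"

definition exc :: "nat \<Rightarrow> (nat \<Rightarrow> nat) \<Rightarrow> nat" where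
  "exc n s = card {i \<in> {1..n}. s i > i}"

definition invc :: "nat \<Rightarrow> (nat \<Rightarrow> nat) \<Rightarrow> nat" where
  "invc n s = card {(i, j). 1 \<le> i \<and> i < j \<and> j \<le> n \<and> s i > s j}"

definition pat31_2 :: "nat \<Rightarrow> (nat \<Rightarrow> nat) \<Rightarrow> nat" where
  "pat31_2 n s = card {(i, j). 1 \<le> i \<and> i + 1 < j \<and> j \<le> n \<and> s i > s j \<and> s j > s (i + 1)}"

definition pat2_31 :: "nat \<Rightarrow> (nat \<Rightarrow> nat) \<Rightarrow> nat" where
  "pat2_31 n s = card {(i, j). 1 \<le> j \<and> j + 1 < i \<and> i \<le> n \<and> s (i - 1) > s j \<and> s j > s i}"

definition pat2_13 :: "nat \<Rightarrow> (nat \<Rightarrow> nat) \<Rightarrow> nat" where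
  "pat2_13 n s = card {(i, j). 1 \<le> j \<and> j + 1 < i \<and> i \<le> n \<and> s (i - 1) < s j \<and> s j < s i}"

end

(*
  Both sums are computed by adding the letters n, n - 1, ..., 1 one after the other and recording
  only the number h of open places of the partial object. One step turns the weighted sum of
  g(h) into the weighted sum of (T g)(h) for a tridiagonal operator T, so that each side becomes a
  matrix entry of T^n (equivalently, the coefficient of a continued fraction).

  For permutations weighted by x^exc y^fix q^inv, T has the entries q^(2h+1) above,
  y q^(2h) + (x+1) q^h [h] on and x [h]^2 below the diagonal. For alternating permutations the
  entries are (p,q)-integers with p = q^2 and there is no diagonal part. For x = -1 and y = 0 the
  diagonal vanishes as well, and the two operators agree up to conjugation by a diagonal matrix.
  For x = -1/q and y = 1 the operator factors as T = P Q with bidiagonal P and Q such that Q P has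
  no diagonal part; T^(m+1) = P (Q P)^m Q then reduces this case to the comparison with Q P.
*)

theory Submission
  imports Defs "HOL-Combinatorics.Multiset_Permutations"
begin

section \<open>Tridiagonal operators and splits of a word at a zero\<close>

text \<open>One number is enough as state because a new letter changes the statistics by the numbers
  of open places to its left and right; summed over the places, these powers form a
  \<open>q\<close>- or \<open>(p,q)\<close>-integer in \<open>h\<close>. Without diagonal part, a
  walk from 0 back to 0 sees only the products of the step up from \<open>h\<close> and the step
  down from \<open>h + 1\<close>. For derangements they are \<open>- q^(2h+1) [h+1]^2\<close>, for
  alternating permutations with \<open>p = q^2\<close> they are \<open>q^(2h) [h+1]^2\<close>. Their
  constant ratio \<open>- q\<close>, once for every two steps, is the prefactor of the theorem, and
  the exponent 2 in the statistics is what makes it constant. For permutations the ratio is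
  \<open>- 1/q^2\<close>; the surplus power of \<open>q\<close> disappears when 2-31 is exchanged
  for 2-13, which shifts the count by \<open>n div 2\<close> on every alternating permutation of odd
  size.\<close>

definition qint :: "'a::comm_ring_1 \<Rightarrow> nat \<Rightarrow> 'a" where
  "qint q k = (\<Sum>i<k. q ^ i)"

text \<open>A division-free form of \<open>(p ^ k - q ^ k) / (p - q)\<close>, meaningful also for
  \<open>p = q\<close>.\<close>

definition pqint :: "'a::comm_ring_1 \<Rightarrow> 'a \<Rightarrow> nat \<Rightarrow> 'a" where
  "pqint p q k = (\<Sum>i<k. q ^ i * p ^ (k - 1 - i))"

lemma qint_0 [simp]: "qint q 0 = 0"
  and qint_Suc: "qint q (Suc k) = qint q k + q ^ k"
  by (simp_all add: qint_def)

text \<open>Trades powers of \<open>q\<close> for \<open>q\<close>-integers when the intertwining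
  relation for permutations is verified.\<close>

lemma qint_geometric: "q ^ k = 1 + qint q k * (q - 1)"
proof (induction k)
  case (Suc k)
  have "q ^ Suc k = q ^ k + q ^ k * (q - 1)"
    by (simp add: algebra_simps)
  also have "\<dots> = 1 + qint q (Suc k) * (q - 1)"
    by (subst (1) Suc) (simp add: qint_Suc algebra_simps)
  finally show ?case .
qed simp

lemma pqint_0 [simp]: "pqint p q 0 = 0"
  by (simp add: pqint_def)

lemma pqint_Suc: "pqint p q (Suc k) = p ^ k + q * pqint p q k"
  unfolding pqint_def sum.lessThan_Suc_shift
  by (simp add: sum_distrib_left mult.assoc)

lemma pqint_1_right: "pqint q 1 k = qint q k"
  by (induction k) (simp_all add: pqint_Suc qint_Suc)

text \<open>For \<open>p = q^2\<close> each summand is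
  \<open>q ^ i * q ^ (2 * (k - i)) = q ^ k * q ^ (k - i)\<close>, so a common power of
  \<open>q\<close> splits off.\<close>

lemma pqint_square: "pqint (q\<^sup>2) q (Suc k) = q ^ k * qint q (Suc k)"
proof (induction k)
  case (Suc k)
  show ?case
    unfolding pqint_Suc[of _ _ "Suc k"] Suc qint_Suc[of _ "Suc k"]
    by (simp add: algebra_simps power2_eq_square power_mult_distrib)
qed (simp add: pqint_def qint_def)

text \<open>At \<open>h = 0\<close> the truncated \<open>h - 1\<close> is again 0, so the last term
  is a true subdiagonal entry only if \<open>d 0 = 0\<close>.\<close>

definition tridiag ::
  "(nat \<Rightarrow> 'a) \<Rightarrow> (nat \<Rightarrow> 'a) \<Rightarrow> (nat \<Rightarrow> 'a) \<Rightarrow> (nat \<Rightarrow> 'a) \<Rightarrow> nat \<Rightarrow> 'a::comm_ring_1" where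
  "tridiag u b d g h = u h * g (Suc h) + b h * g h + d h * g (h - 1)"

lemma funpow_tridiag:
  "(tridiag u b d ^^ Suc n) g h = u h * (tridiag u b d ^^ n) g (Suc h) +
    b h * (tridiag u b d ^^ n) g h + d h * (tridiag u b d ^^ n) g (h - 1)"
  by (simp add: tridiag_def[of _ _ _ "(tridiag u b d ^^ n) g"])

abbreviation delta :: "nat \<Rightarrow> nat \<Rightarrow> 'a::zero_neq_one" where
  "delta k \<equiv> \<lambda>h. of_bool (h = k)"

text \<open>Without diagonal part every step changes the parity of the state.\<close>

lemma tridiag_parity:
  assumes "d 0 = 0" "odd (n + h)"
  shows "(tridiag u (\<lambda>_. 0) d ^^ n) (delta 0) h = 0"
  using assms(2)
proof (induction n arbitrary: h)
  case 0
  then show ?case by (cases h) auto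
next
  case (Suc n)
  have "d h * (tridiag u (\<lambda>_. 0) d ^^ n) (delta 0) (h - 1) = 0"
    using Suc.prems Suc.IH[of "h - 1"] assms(1) by (cases h) auto
  then show ?case
    using Suc.prems Suc.IH[of "Suc h"] unfolding funpow_tridiag by simp
qed

text \<open>
  Two operators without diagonal part are conjugate by the diagonal matrix \<open>c\<close> up to the factor \<open>r\<close>
  per pair of steps. The identity is multiplied out so that no \<open>q\<close>-integer is inverted, since
  \<open>q\<close> may be a root of unity.
\<close>

lemma tridiag_gauge:
  fixes r :: "'a::field"
  assumes r: "r \<noteq> 0"
    and up: "\<And>h. u h * c (Suc h) = r * c h * u' h"
    and down: "\<And>h. d (Suc h) * c h = c (Suc h) * d' (Suc h)"
    and zero: "d 0 = 0" "d' 0 = 0" "c 0 = 1"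
    and "even (n + h)"
  shows "r ^ h * (tridiag u (\<lambda>_. 0) d ^^ n) (delta 0) h =
    r ^ ((n + h) div 2) * c h * (tridiag u' (\<lambda>_. 0) d' ^^ n) (delta 0) h"
  using assms(7)
proof (induction n arbitrary: h)
  case 0
  then show ?case using zero by (cases h) auto
next
  case (Suc n)
  let ?X = "(tridiag u (\<lambda>_. 0) d ^^ n) (delta 0)" and ?Y = "(tridiag u' (\<lambda>_. 0) d' ^^ n) (delta 0)"
  have e: "even (n + Suc h)" using Suc.prems by simp
  \<comment> \<open>The normalization \<open>r ^ h\<close> lacks one factor \<open>r\<close> for the
    state \<open>Suc h\<close>; \<open>up\<close> yields the same factor on the other side, and it
    is cancelled.\<close>
  have "r * (r ^ h * (u h * ?X (Suc h))) = u h * (r ^ Suc h * ?X (Suc h))"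
    by (simp add: mult_ac)
  also have "\<dots> = r ^ ((n + Suc h) div 2) * (u h * c (Suc h)) * ?Y (Suc h)"
    by (subst Suc.IH[OF e]) (simp add: mult_ac)
  also have "\<dots> = r * (r ^ ((Suc n + h) div 2) * c h * (u' h * ?Y (Suc h)))"
    by (subst up) (simp add: mult_ac)
  finally have 1: "r ^ h * (u h * ?X (Suc h)) = r ^ ((Suc n + h) div 2) * c h * (u' h * ?Y (Suc h))"
    using r by (simp only: mult_cancel_left simp_thms)
  have 2: "r ^ h * (d h * ?X (h - 1)) = r ^ ((Suc n + h) div 2) * c h * (d' h * ?Y (h - 1))"
  proof (cases h)
    case 0
    then show ?thesis using zero by simp
  next
    case (Suc k)
    then have e: "even (n + k)" using Suc.prems by simp
    have "r ^ h * (d h * ?X (h - 1)) = r * d (Suc k) * (r ^ k * ?X k)"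
      using Suc by (simp add: mult_ac)
    also have "\<dots> = r * r ^ ((n + k) div 2) * (d (Suc k) * c k) * ?Y k"
      by (subst Suc.IH[OF e]) (simp add: mult_ac)
    also have "\<dots> = r ^ ((Suc n + h) div 2) * c h * (d' h * ?Y (h - 1))"
      using Suc by (subst down) (simp add: mult_ac)
    finally show ?thesis .
  qed
  show ?case
    by (simp only: funpow_tridiag distrib_left 1 2 mult_zero_left mult_zero_right add_0_right)
qed

section \<open>Words with a marked zero\<close>

definition zeros :: "nat list \<Rightarrow> nat" where
  "zeros w = count_list w 0"

primrec zero_splits :: "nat list \<Rightarrow> (nat list \<times> nat list) set" where
  "zero_splits [] = {}"
| "zero_splits (a # w) = (if a = 0 then {([], w)} else {}) \<union> (\<lambda>(u, r). (a # u, r)) ` zero_splits w"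

lemma zeros_simps [simp]:
  "zeros [] = 0" "zeros (x # w) = of_bool (x = 0) + zeros w" "zeros (u @ w) = zeros u + zeros w"
  by (auto simp: zeros_def)

lemma zero_splits_iff: "(u, r) \<in> zero_splits w \<longleftrightarrow> u @ 0 # r = w"
proof (induction w arbitrary: u)
  case (Cons a w)
  show ?case
  proof (cases u)
    case Nil
    then show ?thesis by auto
  next
    case (Cons b v)
    then have "(u, r) \<in> zero_splits (a # w) \<longleftrightarrow> b = a \<and> (v, r) \<in> zero_splits w"
      by auto
    with Cons.IH Cons show ?thesis by simp
  qed
qed simp

lemma finite_zero_splits [simp]: "finite (zero_splits w)"
  by (induction w) simp_all

lemma sum_zero_splits_Cons:
  fixes F :: "nat list \<Rightarrow> nat list \<Rightarrow> 'b::comm_monoid_add"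
  shows "(\<Sum>(u, r)\<in>zero_splits (a # w). F u r) =
    (if a = 0 then F [] w else 0) + (\<Sum>(u, r)\<in>zero_splits w. F (a # u) r)"
proof -
  have "(\<Sum>(u, r)\<in>(\<lambda>(u, r). (a # u, r)) ` zero_splits w. F u r) = (\<Sum>(u, r)\<in>zero_splits w. F (a # u) r)"
    by (subst sum.reindex) (auto simp: inj_on_def case_prod_unfold)
  moreover have "([], w) \<notin> (\<lambda>(u, r). (a # u, r)) ` zero_splits w"
    by auto
  ultimately show ?thesis
    by (cases "a = 0") (simp_all del: insert_iff image_iff)
qed

text \<open>Among \<open>k\<close> zeros, the marked one has \<open>i\<close> to its left and
  \<open>k - 1 - i\<close> to its right, and \<open>i\<close> runs through all values below
  \<open>k\<close>. All \<open>(p,q)\<close>-integers in the operators arise here.\<close>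

lemma sum_zero_splits: "(\<Sum>(u, r)\<in>zero_splits w. q ^ zeros u * p ^ zeros r) = pqint p q (zeros w)"
proof (induction w)
  case (Cons a w)
  have "(\<Sum>(u, r)\<in>zero_splits w. q ^ zeros (a # u) * p ^ zeros r) =
      q ^ of_bool (a = 0) * (\<Sum>(u, r)\<in>zero_splits w. q ^ zeros u * p ^ zeros r)"
    by (auto simp: sum_distrib_left case_prod_unfold power_add mult.assoc)
  with Cons show ?case
    by (subst sum_zero_splits_Cons) (auto simp: pqint_Suc)
qed simp

lemma finite_zero_splits_filter [simp]: "finite {(u, r). (u, r) \<in> zero_splits w \<and> P u r}"
  by (rule finite_subset[OF _ finite_zero_splits[of w]]) auto

lemma zero_splits_UN:
  "{(u, r). u @ 0 # r \<in> Z \<and> P u r} = (\<Union>w\<in>Z. {(u, r). (u, r) \<in> zero_splits w \<and> P u r})"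
  by (auto simp: zero_splits_iff)

text \<open>Groups the outcomes of one insertion by the old word, which is determined by
  \<open>u\<close> and \<open>r\<close>.\<close>

lemma sum_zero_splits_UN:
  fixes F :: "nat list \<Rightarrow> nat list \<Rightarrow> 'b::comm_monoid_add"
  assumes "finite Z"
  shows "(\<Sum>(u, r) | u @ 0 # r \<in> Z \<and> P u r. F u r) =
    (\<Sum>w\<in>Z. \<Sum>(u, r) | (u, r) \<in> zero_splits w \<and> P u r. F u r)"
  unfolding zero_splits_UN using assms
  by (subst sum.UNION_disjoint) (simp_all, auto simp: zero_splits_iff)

lemma finite_zero_splits_UN:
  fixes Z :: "nat list set"
  assumes "finite Z"
  shows "finite {(u, r). u @ 0 # r \<in> Z \<and> P u r}"
  unfolding zero_splits_UN using assms by simp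

section \<open>Excedances, fixed points and inversions\<close>

definition below :: "nat \<Rightarrow> nat list \<Rightarrow> nat" where
  "below v w = length (filter (\<lambda>x. x < v) w)"

primrec inv_list :: "nat list \<Rightarrow> nat" where
  "inv_list [] = 0"
| "inv_list (a # w) = below a w + inv_list w"

text \<open>Words are suffixes ending with row \<open>n\<close>, so the row of a letter is known
  from the number of letters after it. An open place gets weight 1: its value will be smaller than
  its row.\<close>

primrec rook_weight :: "nat \<Rightarrow> 'a::comm_ring_1 \<Rightarrow> 'a \<Rightarrow> nat list \<Rightarrow> 'a" where
  "rook_weight n x y [] = 1"
| "rook_weight n x y (v # w) =
    (if n - length w < v then x else if v = n - length w then y else 1) * rook_weight n x y w"

text \<open>
  The \<open>i\<close>-th letter of a word in \<open>placements n m\<close> is the image of row \<open>m + 1 + i\<close>; the letter \<open>0\<close> stands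
  for a value at most \<open>m\<close> that is still to be chosen. Columns in \<open>open_cols\<close> will be taken by rows
  at most \<open>m\<close>, hence to the left of the whole word; the sum over them in \<open>placement_weight\<close> counts
  the inversions that this is bound to create.
\<close>

definition placements :: "nat \<Rightarrow> nat \<Rightarrow> nat list set" where
  "placements n m = {w. length w = n - m \<and> set w \<subseteq> insert 0 {Suc m..n} \<and> distinct (filter (\<lambda>x. x \<noteq> 0) w)}"

definition open_cols :: "nat \<Rightarrow> nat \<Rightarrow> nat list \<Rightarrow> nat set" where
  "open_cols n m w = {Suc m..n} - set w"

definition placement_weight :: "nat \<Rightarrow> 'a::comm_ring_1 \<Rightarrow> 'a \<Rightarrow> 'a \<Rightarrow> nat \<Rightarrow> nat list \<Rightarrow> 'a" where
  "placement_weight n x y q m w =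
    rook_weight n x y w * q ^ (inv_list w + (\<Sum>v\<in>open_cols n m w. below v w))"

lemma below_simps [simp]:
  "below v [] = 0" "below v (x # w) = of_bool (x < v) + below v w"
  "below v (u @ w) = below v u + below v w"
  by (auto simp: below_def)

lemma below_0 [simp]: "below 0 w = 0"
  by (simp add: below_def)

lemma below_eq_zeros: "set w \<subseteq> insert 0 {Suc m..n} \<Longrightarrow> k \<in> {1..Suc m} \<Longrightarrow> below k w = zeros w"
  by (induction w) auto

lemma length_zeros: "length w = zeros w + length (filter (\<lambda>x. x \<noteq> 0) w)"
  by (induction w) auto

lemma finite_open_cols [simp]: "finite (open_cols n m w)"
  by (simp add: open_cols_def)

lemma finite_placements [simp]: "finite (placements n m)"
  by (rule finite_subset[OF _ finite_lists_length_eq[of "insert 0 {Suc m..n}" "n - m"]])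
    (auto simp: placements_def)

text \<open>There are as many rows as columns above \<open>m\<close>, and the nonzero letters match
  some of both; hence equally many remain, and one \<open>h\<close> counts open rows and open
  columns.\<close>

lemma card_open_cols:
  assumes "w \<in> placements n m"
  shows "card (open_cols n m w) = zeros w"
proof -
  let ?f = "filter (\<lambda>x. x \<noteq> 0) w"
  have sub: "set ?f \<subseteq> {Suc m..n}"
    using assms by (auto simp: placements_def)
  have "open_cols n m w = {Suc m..n} - set ?f"
    by (auto simp: open_cols_def)
  then have "card (open_cols n m w) = (n - m) - card (set ?f)"
    using sub by (simp add: card_Diff_subset)
  moreover have "card (set ?f) = length ?f"
    using assms by (intro distinct_card) (simp add: placements_def)
  moreover have "n - m = zeros w + length ?f"
    using assms length_zeros[of w] by (simp add: placements_def)
  ultimately show ?thesis by linarith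
qed

text \<open>From the largest element downwards the exponents are 0, 1, 2, and so on; the induction
  adds a new minimum.\<close>

lemma sum_power_card_greater:
  fixes q :: "'a::comm_ring_1"
  assumes "finite U"
  shows "(\<Sum>v\<in>U. q ^ card {v' \<in> U. v < v'}) = qint q (card (U :: nat set))"
  using assms
proof (induction U rule: finite_linorder_min_induct)
  case (insert b A)
  have "{v' \<in> insert b A. b < v'} = A"
    using insert by auto
  moreover have "{v' \<in> insert b A. v < v'} = {v' \<in> A. v < v'}" if "v \<in> A" for v
    using insert that by force
  moreover have "b \<notin> A"
    using insert by auto
  ultimately show ?case
    using insert by (simp add: qint_Suc)
qed simp

lemma rook_weight_replace:
  assumes "0 < k" "k + length u + length r < n"
  shows "rook_weight n x y (u @ k # r) = rook_weight n x y (u @ 0 # r)"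
  using assms(2) assms(1) by (induction u) auto

text \<open>All other nonzero letters exceed \<open>k\<close>, so \<open>k\<close> and 0 compare
  alike with everything except the zeros to the right.\<close>

lemma inv_list_replace:
  assumes "set (u @ r) \<subseteq> insert 0 {Suc k..n}" "0 < k"
  shows "inv_list (u @ k # r) = inv_list (u @ 0 # r) + zeros r"
  using assms(1)
proof (induction u)
  case Nil
  then show ?case
    using assms(2) below_eq_zeros[of r k n k] by simp
next
  case (Cons a u)
  then show ?case by (cases "a = 0") auto
qed

text \<open>
  Going from \<open>Suc m\<close> to \<open>m\<close>, first the value \<open>Suc m\<close> is left open or replaces one of the zeros, and
  then the row \<open>Suc m\<close> is put in front.
\<close>

lemma placements_Suc:
  assumes "m < n"
  shows "placements n m = (\<lambda>(w, v). v # w) ` (SIGMA w : placements n (Suc m) \<union>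
    (\<lambda>(u, r). u @ Suc m # r) ` {(u, r). u @ 0 # r \<in> placements n (Suc m) \<and> True}.
    insert 0 ({Suc m..n} - set w))" (is "_ = _ ` Sigma (_ \<union> ?G) ?V")
proof (intro set_eqI iffI)
  have "insert 0 {Suc m..n} - {Suc m} \<subseteq> insert 0 {Suc (Suc m)..n}"
    by auto
  then have above: "A \<subseteq> insert 0 {Suc (Suc m)..n}" if "A \<subseteq> insert 0 {Suc m..n}" "Suc m \<notin> A" for A
    using that by blast
  fix w assume w: "w \<in> placements n m"
  then obtain v w' where [simp]: "w = v # w'"
    using assms by (cases w) (auto simp: placements_def)
  have v: "v \<in> ?V w'" and len: "length w' = n - Suc m"
    and set: "set w' \<subseteq> insert 0 {Suc m..n}" and dist: "distinct (filter (\<lambda>x. x \<noteq> 0) w')"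
    using w by (auto simp: placements_def split: if_splits)
  have "w' \<in> placements n (Suc m) \<union> ?G"
  proof (cases "Suc m \<in> set w'")
    case True
    then obtain u r where [simp]: "w' = u @ Suc m # r"
      by (metis split_list)
    have "Suc m \<notin> set u \<union> set r"
      using dist by auto
    moreover have "set u \<union> set r \<subseteq> insert 0 {Suc m..n}"
      using set by auto
    ultimately have "set u \<union> set r \<subseteq> insert 0 {Suc (Suc m)..n}"
      using above[of "set u \<union> set r"] by simp
    with len dist have "u @ 0 # r \<in> placements n (Suc m)"
      by (auto simp: placements_def)
    then show ?thesis by auto
  next
    case False
    with set have "set w' \<subseteq> insert 0 {Suc (Suc m)..n}"
      by (rule above)
    with len dist show ?thesis
      by (auto simp: placements_def)
  qed
  with v show "w \<in> (\<lambda>(w, v). v # w) ` Sigma (placements n (Suc m) \<union> ?G) ?V"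
    by auto
next
  fix w assume "w \<in> (\<lambda>(w, v). v # w) ` Sigma (placements n (Suc m) \<union> ?G) ?V"
  then obtain v w' where [simp]: "w = v # w'" and w': "w' \<in> placements n (Suc m) \<union> ?G" and v: "v \<in> ?V w'"
    by (elim imageE SigmaE) (hypsubst, unfold prod.case, rule that)
  have "length w' = n - Suc m" "set w' \<subseteq> insert 0 {Suc m..n}" "distinct (filter (\<lambda>x. x \<noteq> 0) w')"
    using w' assms by (auto simp: placements_def subset_iff)
  with v assms show "w \<in> placements n m"
    by (auto simp: placements_def)
qed

text \<open>Reduces the step to a fixed old word. No old word contains \<open>Suc m\<close>, which
  therefore reveals whether and where a zero was replaced.\<close>

lemma sum_placements_Suc:
  fixes f :: "nat list \<Rightarrow> 'a::comm_ring_1"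
  assumes "m < n"
  defines "\<Phi> \<equiv> \<lambda>w. f (0 # w) + (\<Sum>v\<in>{Suc m..n} - set w. f (v # w))"
  shows "(\<Sum>w\<in>placements n m. f w) =
    (\<Sum>w\<in>placements n (Suc m). \<Phi> w + (\<Sum>(u, r)\<in>zero_splits w. \<Phi> (u @ Suc m # r)))"
proof -
  let ?P = "placements n (Suc m)"
  let ?S = "{(u, r). u @ 0 # r \<in> ?P \<and> True}"
  have notin: "Suc m \<notin> set w" if "w \<in> ?P" for w
    using that by (auto simp: placements_def)
  then have notin': "Suc m \<notin> set u" "Suc m \<notin> set r" if "(u, r) \<in> ?S" for u r
    using that notin[of "u @ 0 # r"] by auto
  have inj: "inj_on (\<lambda>(u, r). u @ Suc m # r) ?S"
    using notin' by (auto simp: inj_on_def append_Cons_eq_iff)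
  have fin: "finite ?S"
    by (rule finite_zero_splits_UN) simp
  have inj': "inj_on (\<lambda>(w, v). v # w) A" for A :: "(nat list \<times> nat) set"
    by (auto simp: inj_on_def)
  have "(\<Sum>w\<in>placements n m. f w) =
    (\<Sum>w\<in>?P \<union> (\<lambda>(u, r). u @ Suc m # r) ` ?S. \<Sum>v\<in>insert 0 ({Suc m..n} - set w). f (v # w))"
    unfolding placements_Suc[OF assms(1)]
    by (subst sum.reindex[OF inj'], subst sum.Sigma) (use fin in \<open>simp_all add: case_prod_unfold\<close>)
  also have "\<dots> = (\<Sum>w\<in>?P \<union> (\<lambda>(u, r). u @ Suc m # r) ` ?S. \<Phi> w)"
    by (simp add: \<Phi>_def)
  also have "\<dots> = (\<Sum>w\<in>?P. \<Phi> w) + (\<Sum>w\<in>(\<lambda>(u, r). u @ Suc m # r) ` ?S. \<Phi> w)"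
  proof (rule sum.union_disjoint)
    show "?P \<inter> (\<lambda>(u, r). u @ Suc m # r) ` ?S = {}"
      using notin by fastforce
  qed (use fin in simp_all)
  also have "(\<Sum>w\<in>(\<lambda>(u, r). u @ Suc m # r) ` ?S. \<Phi> w) = (\<Sum>(u, r)\<in>?S. \<Phi> (u @ Suc m # r))"
    by (subst sum.reindex[OF inj]) (simp add: case_prod_unfold)
  also have "\<dots> = (\<Sum>w\<in>?P. \<Sum>(u, r)\<in>zero_splits w. \<Phi> (u @ Suc m # r))"
    by (subst sum_zero_splits_UN) simp_all
  finally show ?thesis
    by (simp add: sum.distrib)
qed

section \<open>Weight change when a row and a column are added\<close>

context
  fixes n m :: nat and w :: "nat list"
  assumes m: "m < n" and w: "w \<in> placements n (Suc m)"
begin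

private abbreviation "U \<equiv> open_cols n (Suc m) w"

private lemma set_w: "set w \<subseteq> insert 0 {Suc (Suc m)..n}"
  using w by (simp add: placements_def)

private lemma row: "n - length w = Suc m"
  using m w by (simp add: placements_def)

private lemma notin: "Suc m \<notin> set w" "Suc m \<notin> U"
  using set_w by (auto simp: open_cols_def)

private lemma below_Suc_m: "below (Suc m) w = zeros w"
  using set_w by (rule below_eq_zeros) simp

private lemma open_cols_insert: "{Suc m..n} - set w = insert (Suc m) U"
  using m notin by (auto simp: open_cols_def)

private lemma card_U: "card U = zeros w"
  using w by (rule card_open_cols)

private lemma sum_Suc_below:
  assumes "\<And>v. v \<in> U \<Longrightarrow> f v = Suc (below v w)"
  shows "(\<Sum>v\<in>U. f v) = zeros w + (\<Sum>v\<in>U. below v w)"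
proof -
  have "(\<Sum>v\<in>U. f v) = (\<Sum>v\<in>U. 1 + below v w)"
    using assms by (intro sum.cong) simp_all
  then show ?thesis
    unfolding sum.distrib using card_U by simp
qed

text \<open>The new open column is charged for \<open>h + 1\<close> zeros, and each of the
  \<open>h\<close> old open columns for the new 0.\<close>

lemma placement_weight_Cons_0:
  "placement_weight n x y q m (0 # w) = q ^ (2 * zeros w + 1) * placement_weight n x y q (Suc m) w"
proof -
  have "open_cols n m (0 # w) = insert (Suc m) U"
    using open_cols_insert by (auto simp: open_cols_def)
  moreover have "(\<Sum>v\<in>U. below v (0 # w)) = zeros w + (\<Sum>v\<in>U. below v w)"
    by (rule sum_Suc_below) (auto simp: open_cols_def)
  ultimately show ?thesis
    using notin by (simp add: placement_weight_def row below_Suc_m power_add mult_2 mult_2_right mult_ac)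
qed

text \<open>The fixed point exceeds the \<open>h\<close> zeros after it and lies below the
  \<open>h\<close> open columns.\<close>

lemma placement_weight_Cons_diag:
  "placement_weight n x y q m (Suc m # w) = y * q ^ (2 * zeros w) * placement_weight n x y q (Suc m) w"
proof -
  have "open_cols n m (Suc m # w) = U"
    by (auto simp: open_cols_def)
  moreover have "(\<Sum>v\<in>U. below v (Suc m # w)) = zeros w + (\<Sum>v\<in>U. below v w)"
    by (rule sum_Suc_below) (auto simp: open_cols_def)
  ultimately show ?thesis
    by (simp add: placement_weight_def row below_Suc_m power_add mult_2 mult_2_right mult_ac)
qed

private lemma sum_below_Cons:
  assumes "v \<in> U"
  shows "below v w + (\<Sum>v'\<in>U - {v}. below v' (v # w)) = (\<Sum>v'\<in>U. below v' w) + card {v' \<in> U. v < v'}"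
proof -
  have "(\<Sum>v'\<in>U - {v}. of_bool (v < v')) = card {v' \<in> U. v < v'}"
    by (subst sum_of_bool_eq) (auto intro: arg_cong[where f = card])
  then show ?thesis
    using assms by (simp add: sum.distrib sum.remove[of U v])
qed

text \<open>The inversions of \<open>v\<close> with \<open>w\<close> were charged while
  \<open>v\<close> was open. New are those of the open column \<open>Suc m\<close> with the
  \<open>h\<close> zeros, and those of the larger open columns with the letter
  \<open>v\<close>.\<close>

lemma placement_weight_Cons_exc:
  assumes v: "v \<in> U"
  shows "placement_weight n x y q m (v # w) =
    x * q ^ zeros w * q ^ card {v' \<in> U. v < v'} * placement_weight n x y q (Suc m) w"
proof -
  have "open_cols n m (v # w) = insert (Suc m) (U - {v})"
    using open_cols_insert v notin by (auto simp: open_cols_def)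
  moreover have "Suc m < v"
    using v by (auto simp: open_cols_def)
  ultimately have "placement_weight n x y q m (v # w) = x * rook_weight n x y w * 
      q ^ (inv_list w + zeros w + (below v w + (\<Sum>v'\<in>U - {v}. below v' (v # w))))"
    using notin by (simp add: placement_weight_def row below_Suc_m add_ac)
  then show ?thesis
    unfolding sum_below_Cons[OF v] by (simp add: placement_weight_def power_add mult_ac)
qed

context
  fixes u r :: "nat list"
  assumes split: "(u, r) \<in> zero_splits w"
begin

private lemma w_eq: "w = u @ 0 # r"
  using split by (simp add: zero_splits_iff)

private lemma below_replace: "v \<in> U \<Longrightarrow> below v (u @ Suc m # r) = below v w"
  by (auto simp: w_eq open_cols_def)

private lemma open_cols_replace: "{Suc m..n} - set (u @ Suc m # r) = U"
  by (auto simp: w_eq open_cols_def)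

private lemma weight_replace: "rook_weight n x y (u @ Suc m # r) = rook_weight n x y w"
  unfolding w_eq using row m w_eq by (intro rook_weight_replace) auto

private lemma inv_replace: "inv_list (u @ Suc m # r) = inv_list w + zeros r"
  unfolding w_eq using set_w w_eq by (intro inv_list_replace[of _ _ _ n]) auto

private lemma row_replace: "n - Suc (length u + length r) = Suc m"
  using row w_eq by simp

text \<open>\<open>Suc m\<close> exceeds the zeros after it, and each of the \<open>h\<close> open
  columns exceeds the new 0.\<close>

lemma placement_weight_replace_Cons_0:
  "placement_weight n x y q m (0 # u @ Suc m # r) =
    q ^ zeros w * q ^ zeros r * placement_weight n x y q (Suc m) w"
proof -
  have "open_cols n m (0 # u @ Suc m # r) = U"
    using open_cols_replace by (auto simp: open_cols_def)
  moreover have "(\<Sum>v\<in>U. below v (0 # u @ Suc m # r)) = zeros w + (\<Sum>v\<in>U. below v w)"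
    by (rule sum_Suc_below, subst below_simps(2), subst below_replace) (auto simp: open_cols_def)
  ultimately show ?thesis
    using row_replace
    by (simp add: placement_weight_def inv_replace weight_replace power_add mult_ac del: below_simps)
qed

lemma placement_weight_replace_Cons_exc:
  assumes v: "v \<in> U"
  shows "placement_weight n x y q m (v # u @ Suc m # r) =
    x * q ^ zeros r * q ^ card {v' \<in> U. v < v'} * placement_weight n x y q (Suc m) w"
proof -
  have 1: "open_cols n m (v # u @ Suc m # r) = U - {v}"
    using open_cols_replace by (auto simp: open_cols_def)
  have 2: "(\<Sum>v'\<in>U - {v}. below v' (v # u @ Suc m # r)) = (\<Sum>v'\<in>U - {v}. below v' (v # w))"
    by (intro sum.cong refl, subst (1 2) below_simps(2), subst below_replace) auto
  have "Suc m < v"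
    using v by (auto simp: open_cols_def)
  then have "placement_weight n x y q m (v # u @ Suc m # r) = x * rook_weight n x y w * 
      q ^ (inv_list w + zeros r + (below v w + (\<Sum>v'\<in>U - {v}. below v' (v # w))))"
    unfolding placement_weight_def 1 2 using row_replace below_replace[OF v]
    by (simp add: inv_replace weight_replace add_ac del: below_simps)
  then show ?thesis
    unfolding sum_below_Cons[OF v] by (simp add: placement_weight_def power_add mult_ac)
qed

end

text \<open>The state stays the same in three ways: a fixed point (\<open>y\<close>), an open column
  taken by the new row (\<open>x\<close>), an open row taking the new column (1). The last two have
  equal sums apart from \<open>x\<close>, whence the factor \<open>x + 1\<close>.\<close>

lemma placement_weight_step:
  fixes x y q :: "'a::comm_ring_1" and g :: "nat \<Rightarrow> 'a"
  defines "f \<equiv> \<lambda>w. placement_weight n x y q m w * g (zeros w)"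
  defines "\<Phi> \<equiv> \<lambda>w. f (0 # w) + (\<Sum>v\<in>{Suc m..n} - set w. f (v # w))"
  shows "\<Phi> w + (\<Sum>(u, r)\<in>zero_splits w. \<Phi> (u @ Suc m # r)) =
    placement_weight n x y q (Suc m) w *
    tridiag (\<lambda>h. q ^ (2 * h + 1)) (\<lambda>h. y * q ^ (2 * h) + (x + 1) * (q ^ h * qint q h))
      (\<lambda>h. x * (qint q h)\<^sup>2) g (zeros w)"
proof -
  let ?W = "placement_weight n x y q (Suc m) w" and ?h = "zeros w"
  have power_sum: "(\<Sum>v\<in>U. q ^ card {v' \<in> U. v < v'}) = qint q ?h"
    using sum_power_card_greater[of U] card_U by simp
  have "(\<Sum>v\<in>U. f (v # w)) = (\<Sum>v\<in>U. x * q ^ ?h * ?W * g ?h * q ^ card {v' \<in> U. v < v'})"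
  proof (rule sum.cong)
    fix v assume "v \<in> U"
    moreover from this have "v \<noteq> 0" by (auto simp: open_cols_def)
    ultimately show "f (v # w) = x * q ^ ?h * ?W * g ?h * q ^ card {v' \<in> U. v < v'}"
      by (simp add: f_def placement_weight_Cons_exc mult_ac)
  qed simp
  then have 1: "\<Phi> w = ?W * (q ^ (2 * ?h + 1) * g (Suc ?h) +
      (y * q ^ (2 * ?h) + x * q ^ ?h * qint q ?h) * g ?h)"
    using notin unfolding \<Phi>_def open_cols_insert
    by (simp add: placement_weight_Cons_0 placement_weight_Cons_diag f_def power_sum
      algebra_simps flip: sum_distrib_left)
  have 2: "\<Phi> (u @ Suc m # r) = ?W * (q ^ ?h * g ?h + x * qint q ?h * g (?h - 1)) * q ^ zeros r"
    if "(u, r) \<in> zero_splits w" for u r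
  proof -
    have z: "zeros (u @ Suc m # r) = ?h - 1" "zeros (0 # u @ Suc m # r) = ?h"
      using that by (auto simp: zero_splits_iff)
    have "{Suc m..n} - set (u @ Suc m # r) = U"
      using that by (auto simp: zero_splits_iff open_cols_def)
    moreover have "(\<Sum>v\<in>U. f (v # u @ Suc m # r)) =
      (\<Sum>v\<in>U. x * q ^ zeros r * ?W * g (?h - 1) * q ^ card {v' \<in> U. v < v'})"
    proof (rule sum.cong)
      fix v assume v: "v \<in> U"
      moreover from this have "v \<noteq> 0" by (auto simp: open_cols_def)
      ultimately have "zeros (v # u @ Suc m # r) = ?h - 1"
        using z by simp
      then show "f (v # u @ Suc m # r) = x * q ^ zeros r * ?W * g (?h - 1) * q ^ card {v' \<in> U. v < v'}"
        unfolding f_def placement_weight_replace_Cons_exc[OF that v] by (simp add: mult_ac)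
    qed simp
    moreover have "f (0 # u @ Suc m # r) = ?W * q ^ ?h * g ?h * q ^ zeros r"
      unfolding f_def placement_weight_replace_Cons_0[OF that] z by (simp add: mult_ac)
    ultimately show ?thesis
      unfolding \<Phi>_def by (simp add: power_sum algebra_simps flip: sum_distrib_left)
  qed
  have "(\<Sum>(u, r)\<in>zero_splits w. \<Phi> (u @ Suc m # r)) = (\<Sum>(u, r)\<in>zero_splits w.
      ?W * (q ^ ?h * g ?h + x * qint q ?h * g (?h - 1)) * (1 ^ zeros u * q ^ zeros r))"
    using 2 by (intro sum.cong) auto
  also have "\<dots> = ?W * (q ^ ?h * g ?h + x * qint q ?h * g (?h - 1)) * qint q ?h"
    unfolding pqint_1_right[symmetric] sum_zero_splits[symmetric]
    by (simp only: case_prod_unfold sum_distrib_left)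
  finally show ?thesis
    unfolding 1 tridiag_def by (simp add: algebra_simps power2_eq_square)
qed

end

text \<open>General in \<open>g\<close>, since adding a letter replaces \<open>g\<close> by its
  image; the induction therefore peels off the innermost application.\<close>

theorem sum_placement_weight:
  fixes x y q :: "'a::comm_ring_1"
  assumes "k \<le> n"
  shows "(\<Sum>w\<in>placements n (n - k). placement_weight n x y q (n - k) w * g (zeros w)) =
    (tridiag (\<lambda>h. q ^ (2 * h + 1)) (\<lambda>h. y * q ^ (2 * h) + (x + 1) * (q ^ h * qint q h))
      (\<lambda>h. x * (qint q h)\<^sup>2) ^^ k) g 0"
  using assms
proof (induction k arbitrary: g)
  case 0
  have "placements n n = {[]}"
    by (auto simp: placements_def)
  then show ?case
    by (simp add: placement_weight_def open_cols_def)
next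
  case (Suc k)
  then have *: "n - k = Suc (n - Suc k)" "n - Suc k < n" by auto
  have "(\<Sum>w\<in>placements n (n - Suc k). placement_weight n x y q (n - Suc k) w * g (zeros w)) =
    (\<Sum>w\<in>placements n (n - k). placement_weight n x y q (n - k) w *
      tridiag (\<lambda>h. q ^ (2 * h + 1)) (\<lambda>h. y * q ^ (2 * h) + (x + 1) * (q ^ h * qint q h))
        (\<lambda>h. x * (qint q h)\<^sup>2) g (zeros w))"
    unfolding sum_placements_Suc[OF *(2)] *(1)
    by (intro sum.cong refl placement_weight_step *)
  also have "\<dots> = (tridiag (\<lambda>h. q ^ (2 * h + 1)) (\<lambda>h. y * q ^ (2 * h) + (x + 1) * (q ^ h * qint q h))
      (\<lambda>h. x * (qint q h)\<^sup>2) ^^ Suc k) g 0"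
    unfolding funpow_Suc_right o_apply using Suc.prems by (intro Suc.IH) simp
  finally show ?case .
qed

section \<open>Vincular patterns in alternating permutations\<close>

fun descents_across :: "nat \<Rightarrow> nat list \<Rightarrow> nat" where
  "descents_across v (a # b # w) = of_bool (b < v \<and> v < a) + descents_across v (b # w)"
| "descents_across v _ = 0"

fun list_31_2 :: "nat list \<Rightarrow> nat" where
  "list_31_2 (a # b # w) = length (filter (\<lambda>v. b < v \<and> v < a) w) + list_31_2 (b # w)"
| "list_31_2 _ = 0"

primrec list_2_31 :: "nat list \<Rightarrow> nat" where
  "list_2_31 [] = 0"
| "list_2_31 (a # w) = descents_across a w + list_2_31 w"

text \<open>Rejecting the empty word forces odd length: the recursion goes from valley to valley and
  stops at one.\<close>

fun rising_alt :: "nat list \<Rightarrow> bool" where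
  "rising_alt [] \<longleftrightarrow> False"
| "rising_alt [a] \<longleftrightarrow> True"
| "rising_alt (a # b # w) \<longleftrightarrow> a < b \<and> hd w < b \<and> rising_alt w"

text \<open>
  Words recording the relative position of the values above \<open>m\<close> in an alternating permutation: each
  maximal run of smaller values, as well as the left end, is collapsed to a single \<open>0\<close>. If \<open>c\<close> holds,
  the right end also counts as such a run.
\<close>

definition alt_words :: "bool \<Rightarrow> nat \<Rightarrow> nat \<Rightarrow> nat list set" where
  "alt_words c n m = {v. hd v = 0 \<and> rising_alt v \<and> set v = insert 0 {Suc m..n} \<and>
    distinct (filter (\<lambda>x. x \<noteq> 0) v) \<and> (c \<longrightarrow> last v = 0)}"

definition alt_weight :: "'a::comm_ring_1 \<Rightarrow> 'a \<Rightarrow> nat list \<Rightarrow> 'a" where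
  "alt_weight p q v = q ^ list_31_2 v * p ^ list_2_31 v"

section \<open>Peaks and valleys of alternating words\<close>

lemma rising_alt_append:
  assumes "even (length u)"
  shows "rising_alt (u @ x # r) \<longleftrightarrow> rising_alt (u @ [x]) \<and> rising_alt (x # r)"
  using assms
proof (induction u rule: induct_list012)
  case (3 a b u)
  then have "hd (u @ x # r) = hd (u @ [x])"
    by (cases u) auto
  with 3 show ?case by auto
qed auto

text \<open>A peak exceeds its neighbours, so a 0 is a valley.\<close>

lemma rising_alt_zero: "rising_alt (u @ 0 # r) \<Longrightarrow> even (length u)"
  by (induction u rule: induct_list012) auto

lemma rising_alt_snoc:
  assumes "even (length u)" "u \<noteq> []" "rising_alt (u @ [x])"
  shows "x < last u" and "y < last u \<Longrightarrow> rising_alt (u @ [y])"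
proof -
  have "x < last u \<and> (y < last u \<longrightarrow> rising_alt (u @ [y]))"
    using assms
  proof (induction u rule: induct_list012)
    case (3 a b u)
    then show ?case by (cases "u = []") auto
  qed auto
  then show "x < last u" and "y < last u \<Longrightarrow> rising_alt (u @ [y])"
    by auto
qed

lemma rising_alt_Cons:
  assumes "rising_alt (x # r)"
  shows "r \<noteq> [] \<Longrightarrow> x < hd r" and "(r \<noteq> [] \<Longrightarrow> y < hd r) \<Longrightarrow> rising_alt (y # r)"
  using assms by (cases r; simp)+

lemma rising_alt_peak:
  assumes "odd (length u)" "rising_alt (u @ x # r)"
  shows "r \<noteq> [] \<and> last u < x \<and> hd r < x"
  using assms
proof (induction u rule: induct_list012)
  case (2 a)
  then show ?case by (cases r) auto
next
  case (3 a b u)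
  then show ?case by (cases "u = []") auto
qed auto

section \<open>Pattern counts after inserting a new smallest value\<close>

lemma descents_across_0 [simp]: "descents_across 0 w = 0"
  by (induction "0 :: nat" w rule: descents_across.induct) auto

lemma descents_across_snoc:
  "u \<noteq> [] \<Longrightarrow> descents_across v (u @ [x]) = descents_across v u + of_bool (x < v \<and> v < last u)"
  by (induction v u rule: descents_across.induct) auto

lemma descents_across_Cons:
  "descents_across v (a # w) = of_bool (w \<noteq> [] \<and> hd w < v \<and> v < a) + descents_across v w"
  by (cases w) auto

text \<open>Peaks and nonzero valleys exceed \<open>k\<close>, so a descent crosses \<open>k\<close>
  exactly when it ends in a 0, and every 0 but a leading one ends a descent.\<close>

lemma descents_across_rising_alt:
  assumes "rising_alt v" "set v \<subseteq> insert 0 {Suc k..}" "0 < k"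
  shows "descents_across k v = zeros (tl v)"
  using assms
proof (induction v rule: rising_alt.induct)
  case (3 a b w)
  then obtain c w' where "w = c # w'"
    by (cases w) auto
  with 3 show ?case by auto
qed auto

lemma descents_across_insert:
  assumes "a = 0 \<or> k < a"
  shows "descents_across a (u @ 0 # k # 0 # r) = descents_across a (u @ 0 # r)"
  using assms by (induction u rule: induct_list012) auto

lemma descents_across_replace:
  assumes "a = 0 \<or> k < a"
  shows "descents_across a (u @ k # r) = descents_across a (u @ 0 # r)"
  using assms by (induction u rule: induct_list012) (auto simp: descents_across_Cons)

text \<open>Earlier letters see no new descent, because the one from \<open>k\<close> to 0 crosses
  only values below \<open>k\<close>. What is added is the part of \<open>k\<close> as the letter
  2.\<close>

lemma list_2_31_insert:
  assumes "set u \<subseteq> insert 0 {Suc k..}"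
  shows "list_2_31 (u @ 0 # k # 0 # r) = list_2_31 (u @ 0 # r) + descents_across k (0 # r)"
  using assms by (induction u) (auto simp: descents_across_insert Suc_le_eq)

lemma list_2_31_replace:
  assumes "set u \<subseteq> insert 0 {Suc k..}"
  shows "list_2_31 (u @ k # r) = list_2_31 (u @ 0 # r) + descents_across k r"
  using assms by (induction u) (auto simp: descents_across_replace Suc_le_eq)

lemma list_31_2_insert:
  assumes "set r \<subseteq> insert 0 {Suc k..}" "0 < k"
  shows "list_31_2 (u @ 0 # k # 0 # r) = list_31_2 (u @ 0 # r) + descents_across k (u @ [0])"
proof (induction u rule: induct_list012)
  case 1
  then show ?case using assms by (force simp: filter_empty_conv)
next
  case (2 a)
  then show ?case using assms by (force simp: filter_empty_conv)
qed auto

text \<open>A descent that ended in the replaced 0 now ends in \<open>k\<close>, which separates no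
  further letters of \<open>r\<close>; only descents wholly inside \<open>u\<close> gain
  \<open>k\<close> as their letter 2.\<close>

lemma list_31_2_replace:
  assumes "set r \<subseteq> insert 0 {Suc k..}" "0 < k"
  shows "list_31_2 (u @ k # r) = list_31_2 (u @ 0 # r) + descents_across k u"
proof -
  have base: "list_31_2 (k # r) = list_31_2 (0 # r)"
    using assms by (cases r) (force simp: filter_empty_conv)+
  have "filter (\<lambda>v. k < v \<and> v < a) r = filter (\<lambda>v. 0 < v \<and> v < a) r" for a
    using assms by (intro filter_cong) auto
  with base show ?thesis
    by (induction u rule: induct_list012) auto
qed

lemma alt_wordsI:
  assumes "hd v = 0" "rising_alt v" "set v = insert 0 {Suc m..n}"
    "distinct (filter (\<lambda>x. x \<noteq> 0) v)" "c \<Longrightarrow> last v = 0"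
  shows "v \<in> alt_words c n m"
  using assms by (simp add: alt_words_def)

lemma alt_wordsD:
  assumes "v \<in> alt_words c n m"
  shows "hd v = 0" "rising_alt v" "set v = insert 0 {Suc m..n}"
    "distinct (filter (\<lambda>x. x \<noteq> 0) v)" "c \<Longrightarrow> last v = 0"
  using assms by (simp_all add: alt_words_def)

text \<open>
  The value \<open>Suc m\<close> is either a peak inside a run of smaller values or a valley that fills up a run.
\<close>

lemma alt_words_Suc:
  assumes "m < n"
  shows "alt_words c n m =
    (\<lambda>(u, r). u @ 0 # Suc m # 0 # r) ` {(u, r). u @ 0 # r \<in> alt_words c n (Suc m) \<and> True} \<union>
    (\<lambda>(u, r). u @ Suc m # r) ` {(u, r). u @ 0 # r \<in> alt_words c n (Suc m) \<and> u \<noteq> [] \<and> (c \<longrightarrow> r \<noteq> [])}"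
    (is "_ = ?A ` ?P \<union> ?B ` ?V")
proof (intro set_eqI iffI)
  fix v assume v: "v \<in> alt_words c n m"
  then have "Suc m \<in> set v"
    using assms by (auto simp: alt_words_def)
  then obtain u r where v_eq: "v = u @ Suc m # r"
    by (elim exE[OF split_list]) (elim exE)
  note hd = alt_wordsD(1)[OF v, unfolded v_eq] and alt = alt_wordsD(2)[OF v, unfolded v_eq]
    and set = alt_wordsD(3)[OF v] and dist = alt_wordsD(4)[OF v, unfolded v_eq]
    and last = alt_wordsD(5)[OF v, unfolded v_eq]
  have "Suc m \<notin> set u \<union> set r"
    using dist by auto
  moreover have "insert 0 {Suc m..n} - {Suc m} = insert 0 {Suc (Suc m)..n}"
    by auto
  moreover have "set u \<union> set r \<union> {Suc m} = insert 0 {Suc m..n}"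
    using set v_eq by auto
  ultimately have ur: "set u \<union> set r = insert 0 {Suc (Suc m)..n}"
    by blast
  have u: "u \<noteq> []" "hd u = 0"
    using hd by (cases u; simp)+
  \<comment> \<open>An even position is a valley, an odd one a peak.\<close>
  show "v \<in> ?A ` ?P \<union> ?B ` ?V"
  proof (cases "even (length u)")
    case True
    then have "rising_alt (u @ [Suc m])" and r: "rising_alt (Suc m # r)"
      using alt rising_alt_append by blast+
    then have "rising_alt (u @ [0])"
      using rising_alt_snoc[of u "Suc m"] True u by auto
    moreover have "rising_alt (0 # r)"
      using rising_alt_Cons(1)[OF r] by (intro rising_alt_Cons(2)[OF r]) simp
    ultimately have "rising_alt (u @ 0 # r)"
      using rising_alt_append[OF True] by blast
    moreover have "set (u @ 0 # r) = insert 0 {Suc (Suc m)..n}"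
      using ur by auto
    moreover have r': "c \<Longrightarrow> r \<noteq> []"
      using last by auto
    then have "c \<Longrightarrow> last (u @ 0 # r) = 0"
      using last by auto
    moreover have "distinct (filter (\<lambda>x. x \<noteq> 0) (u @ 0 # r))" "hd (u @ 0 # r) = 0"
      using u dist by auto
    ultimately have "u @ 0 # r \<in> alt_words c n (Suc m)"
      by (intro alt_wordsI)
    with u(1) r' have "(u, r) \<in> ?V"
      by simp
    then show ?thesis
      unfolding v_eq by (intro UnI2) (rule rev_image_eqI, auto)
  next
    case False
    then have peak: "r \<noteq> []" "last u < Suc m" "hd r < Suc m"
      using rising_alt_peak[OF False alt] by auto
    \<comment> \<open>A neighbour below \<open>Suc m\<close> can only be 0, so the peak lies inside
      a collapsed run.\<close>
    have "last u \<in> insert 0 {Suc (Suc m)..n}" "hd r \<in> insert 0 {Suc (Suc m)..n}"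
      using u(1) peak(1) ur by (metis UnI1 UnI2 last_in_set hd_in_set)+
    with peak have "last u = 0" "hd r = 0"
      by auto
    then obtain u' r' where [simp]: "u = u' @ [0]" "r = 0 # r'"
      using u(1) peak(1) by (metis append_butlast_last_id list.collapse)
    have "even (length u')"
      using False by simp
    then have "rising_alt (u' @ 0 # r')"
      using alt rising_alt_append[of u' 0 r'] rising_alt_append[of u' 0 "Suc m # r"] by simp
    moreover have "set (u' @ 0 # r') = insert 0 {Suc (Suc m)..n}"
      using ur by auto
    moreover have "c \<Longrightarrow> last (u' @ 0 # r') = 0"
      using last by auto
    moreover have "distinct (filter (\<lambda>x. x \<noteq> 0) (u' @ 0 # r'))"
      using dist by simp
    moreover have "hd (u' @ 0 # r') = 0"
      using u(2) by (cases u') simp_all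
    ultimately have "u' @ 0 # r' \<in> alt_words c n (Suc m)"
      by (intro alt_wordsI)
    then have "(u', r') \<in> ?P"
      by simp
    then show ?thesis
      unfolding v_eq by (intro UnI1) (rule rev_image_eqI, auto)
  qed
next
  have set_eq: "insert (Suc m) (insert 0 {Suc (Suc m)..n}) = insert 0 {Suc m..n}"
    using assms by auto
  fix v assume "v \<in> ?A ` ?P \<union> ?B ` ?V"
  then consider u r where "v = ?A (u, r)" "(u, r) \<in> ?P" | u r where "v = ?B (u, r)" "(u, r) \<in> ?V"
    by blast
  then show "v \<in> alt_words c n m"
  proof cases
    case 1
    then have "u @ 0 # r \<in> alt_words c n (Suc m)"
      by simp
    note hd = alt_wordsD(1)[OF this] and alt = alt_wordsD(2)[OF this] and set = alt_wordsD(3)[OF this]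
      and dist = alt_wordsD(4)[OF this] and last = alt_wordsD(5)[OF this]
    note even = rising_alt_zero[OF alt]
    have "rising_alt v"
      using 1 alt rising_alt_append[OF even, of 0 r] rising_alt_append[OF even, of 0 "Suc m # 0 # r"] by simp
    moreover have "set v = insert (Suc m) (set (u @ 0 # r))"
      using 1 by auto
    then have "set v = insert 0 {Suc m..n}"
      unfolding set set_eq .
    moreover have "Suc m \<notin> set (u @ 0 # r)"
      unfolding set by simp
    then have "distinct (filter (\<lambda>x. x \<noteq> 0) v)"
      using 1 dist by auto
    moreover have "c \<Longrightarrow> last v = 0"
      using 1 last by auto
    moreover have "hd v = 0"
      using 1 hd by (cases u) simp_all
    ultimately show ?thesis
      by (intro alt_wordsI)
  next
    case 2
    then have "u @ 0 # r \<in> alt_words c n (Suc m)" and u: "u \<noteq> []" and r: "c \<Longrightarrow> r \<noteq> []"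
      by simp_all
    note hd = alt_wordsD(1)[OF this(1)] and alt = alt_wordsD(2)[OF this(1)] and set = alt_wordsD(3)[OF this(1)]
      and dist = alt_wordsD(4)[OF this(1)] and last = alt_wordsD(5)[OF this(1)]
    note even = rising_alt_zero[OF alt]
    have alt': "rising_alt (u @ [0])" "rising_alt (0 # r)"
      using alt rising_alt_append[OF even] by blast+
    have mem: "x = 0 \<or> Suc m < x" if "x \<in> set u \<union> set r" for x
    proof -
      have "x \<in> set (u @ 0 # r)" using that by auto
      then show ?thesis unfolding set by auto
    qed
    have "Suc m < last u"
      using rising_alt_snoc(1)[OF even u alt'(1)] mem[of "last u"] u by auto
    moreover have "Suc m < hd r" if "r \<noteq> []"
      using rising_alt_Cons(1)[OF alt'(2)] mem[of "hd r"] that by auto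
    ultimately have "rising_alt v"
      using 2 rising_alt_append[OF even, of "Suc m" r] rising_alt_snoc(2)[OF even u alt'(1)]
        rising_alt_Cons(2)[OF alt'(2)] by simp
    \<comment> \<open>The leading 0 survives, so the letter 0 does not vanish with the replaced
      one.\<close>
    moreover have "0 \<in> set u"
      using hd u by (metis hd_append2 hd_in_set)
    then have "set v = insert (Suc m) (set (u @ 0 # r))"
      using 2 by auto
    then have "set v = insert 0 {Suc m..n}"
      unfolding set set_eq .
    moreover have "Suc m \<notin> set u \<union> set r"
      using mem by blast
    then have "distinct (filter (\<lambda>x. x \<noteq> 0) v)"
      using 2 dist by auto
    moreover have "c \<Longrightarrow> last v = 0" "hd v = 0"
      using 2 last hd u r by auto
    ultimately show ?thesis
      by (intro alt_wordsI)
  qed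
qed

text \<open>The recursion, which starts from \<open>[0]\<close>, spares an explicit bound on the
  length.\<close>

lemma finite_alt_words [simp]: "finite (alt_words c n m)"
proof (induction "n - m" arbitrary: m)
  case 0
  then have "alt_words c n m \<subseteq> {[0]}"
  proof (intro subsetI)
    fix v assume "v \<in> alt_words c n m"
    then have "rising_alt v" "set v \<subseteq> {0}"
      using 0 by (auto simp: alt_words_def)
    then show "v \<in> {[0]}"
      by (cases v rule: rising_alt.cases) auto
  qed
  then show ?case
    by (rule finite_subset) simp
next
  case (Suc k)
  then have "m < n" "k = n - Suc m" by auto
  with Suc show ?case
    by (simp only: alt_words_Suc finite_Un finite_imageI finite_zero_splits_UN)
qed

lemma zeros_tl: "rising_alt v \<Longrightarrow> hd v = 0 \<Longrightarrow> zeros v = Suc (zeros (tl v))"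
  by (cases v) auto

text \<open>The leading 0 is the left end and cannot be filled, nor, under \<open>c\<close>, the
  final 0. The latter lies to the right of every admissible zero, which accounts for the factor
  \<open>p\<close>.\<close>

lemma sum_valley_splits:
  assumes "hd v = 0" "v \<noteq> []" "c \<Longrightarrow> last v = 0"
  shows "(\<Sum>(u, r) | (u, r) \<in> zero_splits v \<and> u \<noteq> [] \<and> (c \<longrightarrow> r \<noteq> []). q ^ (zeros u - 1) * p ^ zeros r) =
    (if c then p * pqint p q (zeros (tl v) - 1) else pqint p q (zeros (tl v)))"
proof -
  obtain t where v: "v = 0 # t"
    using assms by (cases v) auto
  have "{(u, r). (u, r) \<in> zero_splits v \<and> u \<noteq> [] \<and> (c \<longrightarrow> r \<noteq> [])} =
      (\<lambda>(u, r). (0 # u, r)) ` {(u, r). (u, r) \<in> zero_splits t \<and> (c \<longrightarrow> r \<noteq> [])}"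
    unfolding v by auto
  then have sum_t: "(\<Sum>(u, r) | (u, r) \<in> zero_splits v \<and> u \<noteq> [] \<and> (c \<longrightarrow> r \<noteq> []). q ^ (zeros u - 1) * p ^ zeros r) =
      (\<Sum>(u, r) | (u, r) \<in> zero_splits t \<and> (c \<longrightarrow> r \<noteq> []). q ^ zeros u * p ^ zeros r)"
    by (simp only:) (subst sum.reindex, auto simp: inj_on_def case_prod_unfold)
  show ?thesis
  \<comment> \<open>For \<open>c\<close> and \<open>t = []\<close> no zero can be filled; the
    truncated \<open>0 - 1\<close> then gives \<open>pqint p q 0 = 0\<close>.\<close>
  proof (cases "c \<and> t \<noteq> []")
    case False
    then show ?thesis
      unfolding sum_t using sum_zero_splits[of q p t] v by (cases c) simp_all
  next
    case True
    then have "last t = 0"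
      using assms(3) v by simp
    then obtain t' where t: "t = t' @ [0]"
      using True by (metis append_butlast_last_id)
    have "(u, r) \<in> zero_splits t \<and> r \<noteq> [] \<longleftrightarrow> (u, r) \<in> (\<lambda>(u, r). (u, r @ [0])) ` zero_splits t'" for u r
      by (cases r rule: rev_cases) (auto simp: zero_splits_iff t image_iff intro!: bexI[of _ "(u, butlast r)"])
    then have "{(u, r). (u, r) \<in> zero_splits t \<and> (c \<longrightarrow> r \<noteq> [])} = (\<lambda>(u, r). (u, r @ [0])) ` zero_splits t'"
      using True by auto
    then have "(\<Sum>(u, r) | (u, r) \<in> zero_splits t \<and> (c \<longrightarrow> r \<noteq> []). q ^ zeros u * p ^ zeros r) =
        (\<Sum>(u, r)\<in>zero_splits t'. p * (q ^ zeros u * p ^ zeros r))"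
      by (simp only:) (subst sum.reindex, auto simp: inj_on_def case_prod_unfold mult_ac)
    also have "\<dots> = p * pqint p q (zeros t')"
      unfolding sum_zero_splits[symmetric] sum_distrib_left by (simp add: case_prod_unfold)
    finally show ?thesis
      unfolding sum_t using True v t by simp
  qed
qed

section \<open>Weight of a new peak and of a new valley\<close>

context
  fixes c :: bool and n m :: nat and u r :: "nat list"
  assumes ur: "u @ 0 # r \<in> alt_words c n (Suc m)"
begin

private lemma letters: "set (u @ 0 # r) \<subseteq> insert 0 {Suc (Suc m)..}"
  unfolding alt_wordsD(3)[OF ur] by auto

private lemma alt_parts: "rising_alt (u @ [0])" "rising_alt (0 # r)"
  using alt_wordsD(2)[OF ur] rising_alt_append[OF rising_alt_zero[OF alt_wordsD(2)[OF ur]]] by blast+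

private lemma hd_u: "u \<noteq> [] \<Longrightarrow> hd u = 0"
  using alt_wordsD(1)[OF ur] by simp

private lemma across_right: "descents_across (Suc m) (0 # r) = zeros r"
  using descents_across_rising_alt[OF alt_parts(2), of "Suc m"] letters by simp

private lemma across_left: "descents_across (Suc m) (u @ [0]) = zeros u"
proof -
  have "descents_across (Suc m) (u @ [0]) = zeros (tl (u @ [0]))"
    using letters by (intro descents_across_rising_alt[OF alt_parts(1)]) auto
  then show ?thesis
    using hd_u by (cases u) auto
qed

text \<open>In \<open>u @ [0]\<close> all zeros but the leading one end a descent across
  \<open>Suc m\<close>, which makes \<open>zeros u\<close> of them; to the right there are
  \<open>zeros r\<close>.\<close>

lemma alt_weight_peak:
  "alt_weight p q (u @ 0 # Suc m # 0 # r) = alt_weight p q (u @ 0 # r) * (q ^ zeros u * p ^ zeros r)"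
proof -
  have "list_31_2 (u @ 0 # Suc m # 0 # r) = list_31_2 (u @ 0 # r) + zeros u"
    using letters by (subst list_31_2_insert) (auto simp: across_left)
  moreover have "list_2_31 (u @ 0 # Suc m # 0 # r) = list_2_31 (u @ 0 # r) + zeros r"
    using letters across_right by (subst list_2_31_insert) auto
  ultimately show ?thesis
    by (simp add: alt_weight_def power_add mult_ac)
qed

text \<open>One less than for a peak on the left: the descent into the filled place now ends in
  \<open>Suc m\<close> itself.\<close>

lemma alt_weight_valley:
  assumes "u \<noteq> []"
  shows "alt_weight p q (u @ Suc m # r) = alt_weight p q (u @ 0 # r) * (q ^ (zeros u - 1) * p ^ zeros r)"
proof -
  have "0 < last u" "last u \<in> set u"
    using rising_alt_snoc(1)[OF rising_alt_zero[OF alt_wordsD(2)[OF ur]] assms alt_parts(1)] assms by auto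
  then have "Suc m < last u"
    using letters by auto
  then have "Suc (descents_across (Suc m) u) = zeros u"
    using across_left assms by (simp add: descents_across_snoc)
  then have "list_31_2 (u @ Suc m # r) = list_31_2 (u @ 0 # r) + (zeros u - 1)"
    using letters by (subst list_31_2_replace) auto
  moreover have "list_2_31 (u @ Suc m # r) = list_2_31 (u @ 0 # r) + zeros r"
    using letters across_right by (subst list_2_31_replace) (auto simp: descents_across_Cons)
  ultimately show ?thesis
    by (simp add: alt_weight_def power_add mult_ac)
qed

end

text \<open>The state \<open>h = zeros (tl v)\<close> omits the left end. A peak may enter any of
  the \<open>h + 1\<close> zeros and splits it in two; a valley removes one of \<open>h\<close>
  zeros, or of \<open>h - 1\<close> if the right end is kept.\<close>

definition alt_step :: "bool \<Rightarrow> 'a::comm_ring_1 \<Rightarrow> 'a \<Rightarrow> (nat \<Rightarrow> 'a) \<Rightarrow> nat \<Rightarrow> 'a" where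
  "alt_step c p q = tridiag (\<lambda>h. pqint p q (Suc h)) (\<lambda>_. 0)
    (\<lambda>h. if c then p * pqint p q (h - 1) else pqint p q h)"

lemma sum_alt_weight_Suc:
  fixes p q :: "'a::comm_ring_1"
  assumes "m < n"
  shows "(\<Sum>v\<in>alt_words c n m. alt_weight p q v * g (zeros (tl v))) =
    (\<Sum>v\<in>alt_words c n (Suc m). alt_weight p q v * alt_step c p q g (zeros (tl v)))"
proof -
  let ?A = "alt_words c n (Suc m)" and ?f = "\<lambda>v. alt_weight p q v * g (zeros (tl v))"
  let ?P = "{(u, r). u @ 0 # r \<in> ?A \<and> True}"
  let ?V = "{(u, r). u @ 0 # r \<in> ?A \<and> u \<noteq> [] \<and> (c \<longrightarrow> r \<noteq> [])}"
  let ?p = "\<lambda>(u, r). u @ 0 # Suc m # 0 # r" and ?v = "\<lambda>(u, r). u @ Suc m # r"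
  have fin: "finite ?P" "finite ?V"
    by (rule finite_zero_splits_UN, simp)+
  have notin: "Suc m \<notin> set u" "Suc m \<notin> set r" if "u @ 0 # r \<in> ?A" for u r
  proof -
    have "Suc m \<notin> set (u @ 0 # r)"
      unfolding alt_wordsD(3)[OF that] by simp
    then show "Suc m \<notin> set u" "Suc m \<notin> set r"
      by simp_all
  qed
  have inj_p: "inj_on ?p ?P"
  proof (rule inj_onI, clarify)
    fix u r u' r' assume "u @ 0 # r \<in> ?A" "u' @ 0 # r' \<in> ?A"
      and "u @ 0 # Suc m # 0 # r = u' @ 0 # Suc m # 0 # r'"
    then show "u = u' \<and> r = r'"
      using notin append_Cons_eq_iff[of "Suc m" "u @ [0]" "0 # r" "u' @ [0]" "0 # r'"] by auto
  qed
  have inj_v: "inj_on ?v ?V"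
  proof (rule inj_onI, clarify)
    fix u r u' r' assume "u @ 0 # r \<in> ?A" "u' @ 0 # r' \<in> ?A" "u @ Suc m # r = u' @ Suc m # r'"
    then show "u = u' \<and> r = r'"
      using notin append_Cons_eq_iff[of "Suc m" u r u' r'] by auto
  qed
  \<comment> \<open>\<open>Suc m\<close> has an odd position in the first image and an even one in
    the second.\<close>
  have disj: "?p ` ?P \<inter> ?v ` ?V = {}"
  proof -
    have False if a: "u @ 0 # r \<in> ?A" "u' @ 0 # r' \<in> ?A" and eq: "u @ 0 # Suc m # 0 # r = u' @ Suc m # r'"
      for u r u' r'
    proof -
      have "u @ [0] = u'"
        using eq notin[OF a(1)] notin[OF a(2)] append_Cons_eq_iff[of "Suc m" "u @ [0]" "0 # r" u' r'] by auto
      then show False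
        using rising_alt_zero[OF alt_wordsD(2)[OF a(1)]] rising_alt_zero[OF alt_wordsD(2)[OF a(2)]] by auto
    qed
    then show ?thesis
      by (intro equals0I, elim IntE imageE, clarify)
  qed
  have zeros_P: "zeros (tl (u @ 0 # Suc m # 0 # r)) = Suc (zeros (tl (u @ 0 # r)))" if "u @ 0 # r \<in> ?A" for u r
    by (cases u) auto
  have zeros_V: "zeros (tl (u @ Suc m # r)) = zeros (tl (u @ 0 # r)) - 1" if "u \<noteq> []" for u r
    using that by (cases u) auto
  have "(\<Sum>v\<in>alt_words c n m. ?f v) = (\<Sum>v\<in>?p ` ?P. ?f v) + (\<Sum>v\<in>?v ` ?V. ?f v)"
    unfolding alt_words_Suc[OF assms] using fin disj by (intro sum.union_disjoint finite_imageI)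
  also have "(\<Sum>v\<in>?p ` ?P. ?f v) = (\<Sum>(u, r)\<in>?P. ?f (u @ 0 # Suc m # 0 # r))"
    by (subst sum.reindex[OF inj_p]) (simp add: case_prod_unfold)
  also have "\<dots> = (\<Sum>v\<in>?A. \<Sum>(u, r) | (u, r) \<in> zero_splits v \<and> True. ?f (u @ 0 # Suc m # 0 # r))"
    by (rule sum_zero_splits_UN) simp
  also have "\<dots> = (\<Sum>v\<in>?A. alt_weight p q v * (pqint p q (Suc (zeros (tl v))) * g (Suc (zeros (tl v)))))"
  proof (rule sum.cong)
    fix v assume v: "v \<in> ?A"
    have "(\<Sum>(u, r)\<in>zero_splits v. ?f (u @ 0 # Suc m # 0 # r)) =
        (\<Sum>(u, r)\<in>zero_splits v. alt_weight p q v * g (Suc (zeros (tl v))) * (q ^ zeros u * p ^ zeros r))"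
      using v by (intro sum.cong refl)
        (auto simp: zero_splits_iff alt_weight_peak zeros_P mult_ac simp del: tl_append)
    also have "\<dots> = alt_weight p q v * g (Suc (zeros (tl v))) * pqint p q (zeros v)"
      unfolding sum_zero_splits[symmetric] sum_distrib_left by (simp add: case_prod_unfold)
    finally show "(\<Sum>(u, r) | (u, r) \<in> zero_splits v \<and> True. ?f (u @ 0 # Suc m # 0 # r)) =
        alt_weight p q v * (pqint p q (Suc (zeros (tl v))) * g (Suc (zeros (tl v))))"
      using zeros_tl[OF alt_wordsD(2,1)[OF v]] by (simp add: mult_ac)
  qed simp
  also have "(\<Sum>v\<in>?v ` ?V. ?f v) = (\<Sum>(u, r)\<in>?V. ?f (u @ Suc m # r))"
    by (subst sum.reindex[OF inj_v]) (simp add: case_prod_unfold)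
  also have "\<dots> = (\<Sum>v\<in>?A. \<Sum>(u, r) | (u, r) \<in> zero_splits v \<and> u \<noteq> [] \<and> (c \<longrightarrow> r \<noteq> []). ?f (u @ Suc m # r))"
    by (rule sum_zero_splits_UN) simp
  also have "\<dots> = (\<Sum>v\<in>?A. alt_weight p q v *
      ((if c then p * pqint p q (zeros (tl v) - 1) else pqint p q (zeros (tl v))) * g (zeros (tl v) - 1)))"
  proof (rule sum.cong)
    fix v assume v: "v \<in> ?A"
    let ?S = "{(u, r). (u, r) \<in> zero_splits v \<and> u \<noteq> [] \<and> (c \<longrightarrow> r \<noteq> [])}"
    have "v \<noteq> []"
      using alt_wordsD(2)[OF v] by auto
    have "(\<Sum>(u, r)\<in>?S. ?f (u @ Suc m # r)) =
        (\<Sum>(u, r)\<in>?S. alt_weight p q v * g (zeros (tl v) - 1) * (q ^ (zeros u - 1) * p ^ zeros r))"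
      using v by (intro sum.cong refl)
        (auto simp: zero_splits_iff alt_weight_valley zeros_V mult_ac simp del: tl_append)
    also have "\<dots> = alt_weight p q v * g (zeros (tl v) - 1) *
        (if c then p * pqint p q (zeros (tl v) - 1) else pqint p q (zeros (tl v)))"
      by (subst sum_valley_splits[where p = p and q = q and c = c, symmetric])
        (use \<open>v \<noteq> []\<close> alt_wordsD(1,5)[OF v] in \<open>simp_all add: sum_distrib_left case_prod_unfold\<close>)
    finally show "(\<Sum>(u, r)\<in>?S. ?f (u @ Suc m # r)) = alt_weight p q v *
      ((if c then p * pqint p q (zeros (tl v) - 1) else pqint p q (zeros (tl v))) * g (zeros (tl v) - 1))"
      by (simp add: mult_ac)
  qed simp
  finally show ?thesis
    by (simp add: alt_step_def tridiag_def sum.distrib distrib_left)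
qed

theorem sum_alt_weight:
  fixes p q :: "'a::comm_ring_1"
  assumes "k \<le> n"
  shows "(\<Sum>v\<in>alt_words c n (n - k). alt_weight p q v * g (zeros (tl v))) = (alt_step c p q ^^ k) g 0"
  using assms
proof (induction k arbitrary: g)
  case 0
  have "v = [0]" if "v \<in> alt_words c n n" for v
    using alt_wordsD(2)[OF that] alt_wordsD(3)[OF that] by (cases v rule: rising_alt.cases) auto
  moreover have "[0] \<in> alt_words c n n"
    by (rule alt_wordsI) auto
  ultimately have "alt_words c n n = {[0]}"
    by blast
  then show ?case
    by (simp add: alt_weight_def)
next
  case (Suc k)
  then have *: "n - k = Suc (n - Suc k)" "n - Suc k < n" by auto
  have "(\<Sum>v\<in>alt_words c n (n - Suc k). alt_weight p q v * g (zeros (tl v))) =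
      (\<Sum>v\<in>alt_words c n (n - k). alt_weight p q v * alt_step c p q g (zeros (tl v)))"
    unfolding *(1) by (rule sum_alt_weight_Suc[OF *(2)])
  also have "\<dots> = (alt_step c p q ^^ Suc k) g 0"
    unfolding funpow_Suc_right o_apply using Suc.prems by (intro Suc.IH) simp
  finally show ?case .
qed

section \<open>Permutations as words\<close>

abbreviation word :: "nat \<Rightarrow> (nat \<Rightarrow> nat) \<Rightarrow> nat list" where
  "word n s \<equiv> map s [Suc 0..<Suc n]"

lemma bij_betw_word: "bij_betw (word n) (perms n) {w. set w = {1..n} \<and> distinct w}"
proof -
  have inj: "inj_on (word n) (perms n)"
  proof (rule inj_onI, rule ext)
    fix s t i assume s: "s \<in> perms n" "t \<in> perms n" and eq: "word n s = word n t"
    show "s i = t i"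
    proof (cases "i \<in> {1..n}")
      case True
      with eq show ?thesis
        by (simp add: atLeastLessThanSuc_atLeastAtMost del: upt_Suc)
    next
      case False
      with s show ?thesis
        unfolding perms_def by (metis mem_Collect_eq permutes_not_in)
    qed
  qed
  have "word n ` perms n \<subseteq> permutations_of_set {1..n}"
  proof (rule image_subsetI)
    fix s assume "s \<in> perms n"
    then have s: "s permutes {1..n}"
      by (simp add: perms_def)
    have "set (word n s) = s ` {1..n}"
      by (simp add: atLeastLessThanSuc_atLeastAtMost del: upt_Suc)
    moreover have "distinct (word n s)"
      using permutes_inj_on[OF s] by (simp add: distinct_map del: upt_Suc)
    ultimately show "word n s \<in> permutations_of_set {1..n}"
      using permutes_image[OF s] by (simp add: permutations_of_set_def)
  qed
  \<comment> \<open>Surjectivity by counting: both sets have \<open>fact n\<close> elements.\<close>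
  moreover have "card (word n ` perms n) = card (permutations_of_set {1..n})"
    using card_image[OF inj] card_permutations[of "{1..n}" n] by (simp add: perms_def del: upt_Suc)
  ultimately have "word n ` perms n = permutations_of_set {1..n}"
    by (intro card_subset_eq) auto
  with inj show ?thesis
    by (simp add: bij_betw_def permutations_of_set_def)
qed

section \<open>Statistics of a permutation read off its word\<close>

lemma length_filter_map_upt: "length (filter P (map s [a..<b])) = card {j. a \<le> j \<and> j < b \<and> P (s j)}"
proof -
  have "length (filter P (map s [a..<b])) = length (filter (P \<circ> s) [a..<b])"
    by (simp add: filter_map)
  also have "\<dots> = card (set (filter (P \<circ> s) [a..<b]))"
    by (rule distinct_card[symmetric]) simp
  also have "set (filter (P \<circ> s) [a..<b]) = {j. a \<le> j \<and> j < b \<and> P (s j)}"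
    by auto
  finally show ?thesis .
qed

text \<open>Mirrors the recursion over the suffixes \<open>map s [m..<Suc n]\<close>; the bound
  \<open>n\<close> provides finiteness.\<close>

lemma card_pairs_fst_ge:
  fixes Q :: "nat \<Rightarrow> nat \<Rightarrow> bool"
  assumes "\<And>i j. Q i j \<Longrightarrow> i \<le> n \<and> j \<le> n"
  shows "card {(i, j). m \<le> i \<and> Q i j} = card {j. Q m j} + card {(i, j). Suc m \<le> i \<and> Q i j}"
proof -
  have fin: "finite {(i, j). k \<le> i \<and> Q i j}" for k
    by (rule finite_subset[of _ "{..n} \<times> {..n}"]) (use assms in auto)
  have "{(i, j). m \<le> i \<and> Q i j} = Pair m ` {j. Q m j} \<union> {(i, j). Suc m \<le> i \<and> Q i j}"
    by (auto simp: Suc_le_eq order_le_less)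
  moreover have "card (Pair m ` {j. Q m j}) = card {j. Q m j}"
    by (intro card_image inj_onI) simp
  moreover have "finite {j. Q m j}"
    by (rule finite_subset[of _ "{..n}"]) (use assms in auto)
  ultimately show ?thesis
    using fin by (simp only:) (subst card_Un_disjoint, auto)
qed

lemma card_pairs_snd_ge:
  fixes Q :: "nat \<Rightarrow> nat \<Rightarrow> bool"
  assumes "\<And>i j. Q i j \<Longrightarrow> i \<le> n \<and> j \<le> n"
  shows "card {(i, j). m \<le> j \<and> Q i j} = card {i. Q i m} + card {(i, j). Suc m \<le> j \<and> Q i j}"
proof -
  have swap: "card {(i, j). k \<le> j \<and> Q i j} = card {(i, j). k \<le> i \<and> Q j i}" for k
    by (rule bij_betw_same_card[of prod.swap]) (auto simp: bij_betw_def inj_on_def image_iff)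
  show ?thesis
    unfolding swap by (rule card_pairs_fst_ge[where Q = "\<lambda>i j. Q j i"]) (use assms in blast)
qed

lemma upt_Cons_Suc: "m \<le> n \<Longrightarrow> [m..<Suc n] = m # [Suc m..<Suc n]"
  by (simp add: upt_conv_Cons del: upt_Suc)

lemma inv_list_word: "inv_list (word n s) = invc n s"
proof -
  have "inv_list (map s [m..<Suc n]) = card {(i, j). m \<le> i \<and> i < j \<and> j \<le> n \<and> s i > s j}" if "m \<le> Suc n" for m
    using that
  proof (induction m rule: inc_induct)
    case base
    have empty: "{(i, j). Suc n \<le> i \<and> i < j \<and> j \<le> n \<and> s i > s j} = {}"
      by auto
    show ?case unfolding empty by simp
  next
    case (step m)
    have "{j. Suc m \<le> j \<and> j < Suc n \<and> s j < s m} = {j. m < j \<and> j \<le> n \<and> s m > s j}"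
      by auto
    then have "inv_list (map s [m..<Suc n]) = card {j. m < j \<and> j \<le> n \<and> s m > s j} + inv_list (map s [Suc m..<Suc n])"
      using step.hyps by (simp add: upt_Cons_Suc[of m] below_def length_filter_map_upt del: upt_Suc length_filter_map)
    moreover have "card {(i, j). m \<le> i \<and> i < j \<and> j \<le> n \<and> s i > s j} =
        card {j. m < j \<and> j \<le> n \<and> s m > s j} + card {(i, j). Suc m \<le> i \<and> i < j \<and> j \<le> n \<and> s i > s j}"
      by (rule card_pairs_fst_ge[of _ n]) simp
    ultimately show ?case
      using step.IH by (simp del: upt_Suc)
  qed
  from this[of "Suc 0"] show ?thesis
    by (simp add: invc_def del: upt_Suc)
qed

lemma prod_if_const: "finite A \<Longrightarrow> (\<Prod>i\<in>A. if P i then c else 1) = c ^ card {i \<in> A. P i}"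
  by (simp add: prod.If_cases Int_def)

lemma rook_weight_word:
  "rook_weight n x y (word n s) = x ^ exc n s * y ^ card {i \<in> {1..n}. s i = i}"
proof -
  have "rook_weight n x y (map s [m..<Suc n]) = (\<Prod>i\<in>{m..n}. (if s i > i then x else 1) * (if s i = i then y else 1))"
    if "m \<le> Suc n" for m
    using that
  proof (induction m rule: inc_induct)
    case (step m)
    then have "{m..n} = insert m {Suc m..n}" "n - (n - m) = m"
      by auto
    with step show ?case
      by (simp add: upt_Cons_Suc del: upt_Suc)
  qed simp
  from this[of "Suc 0"] show ?thesis
    by (simp add: prod.distrib prod_if_const exc_def del: upt_Suc)
qed

lemma list_31_2_word: "list_31_2 (word n s) = pat31_2 n s"
proof -
  have "list_31_2 (map s [m..<Suc n]) =
      card {(i, j). m \<le> i \<and> i + 1 < j \<and> j \<le> n \<and> s i > s j \<and> s j > s (i + 1)}" if "m \<le> Suc n" for m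
    using that
  proof (induction m rule: inc_induct)
    case base
    have empty: "{(i, j). Suc n \<le> i \<and> i + 1 < j \<and> j \<le> n \<and> s i > s j \<and> s j > s (i + 1)} = {}"
      by auto
    show ?case unfolding empty by simp
  next
    case (step m)
    let ?Q = "\<lambda>i j. i + 1 < j \<and> j \<le> n \<and> s i > s j \<and> s j > s (i + 1)"
    have "list_31_2 (map s [m..<Suc n]) = card {j. ?Q m j} + list_31_2 (map s [Suc m..<Suc n])"
    proof (cases "m < n")
      case True
      then have "[m..<Suc n] = m # Suc m # [Suc (Suc m)..<Suc n]" "[Suc m..<Suc n] = Suc m # [Suc (Suc m)..<Suc n]"
        by (simp_all add: upt_Cons_Suc del: upt_Suc)
      moreover have "{j. Suc (Suc m) \<le> j \<and> j < Suc n \<and> s (Suc m) < s j \<and> s j < s m} = {j. ?Q m j}"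
        by auto
      ultimately show ?thesis
        by (simp add: length_filter_map_upt del: upt_Suc length_filter_map)
    next
      case False
      then have "m = n" "{j. ?Q m j} = {}"
        using step.hyps by auto
      then show ?thesis
        by (simp add: upt_Cons_Suc)
    qed
    moreover have "card {(i, j). m \<le> i \<and> ?Q i j} = card {j. ?Q m j} + card {(i, j). Suc m \<le> i \<and> ?Q i j}"
      by (rule card_pairs_fst_ge[of _ n]) simp
    ultimately show ?case
      using step.IH by (simp del: upt_Suc)
  qed
  from this[of "Suc 0"] show ?thesis
    by (simp add: pat31_2_def del: upt_Suc)
qed

fun ascents_across :: "nat \<Rightarrow> nat list \<Rightarrow> nat" where
  "ascents_across v (a # b # w) = of_bool (a < v \<and> v < b) + ascents_across v (b # w)"
| "ascents_across v _ = 0"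

primrec list_2_13 :: "nat list \<Rightarrow> nat" where
  "list_2_13 [] = 0"
| "list_2_13 (a # w) = ascents_across a w + list_2_13 w"

lemma card_steps:
  fixes P :: "nat \<Rightarrow> nat \<Rightarrow> bool"
  assumes "\<And>a. f [a] = 0" "f [] = 0" "\<And>a b w. f (a # b # w) = of_bool (P a b) + f (b # w)"
    and "m \<le> Suc n"
  shows "f (map s [m..<Suc n]) = card {i. Suc m \<le> i \<and> i \<le> n \<and> P (s (i - 1)) (s i)}"
  using assms(4)
proof (induction m rule: inc_induct)
  case base
  have "{i. Suc (Suc n) \<le> i \<and> i \<le> n \<and> P (s (i - 1)) (s i)} = {}"
    by auto
  then show ?case using assms(2) by simp
next
  case (step m)
  show ?case
  proof (cases "m < n")
    case True
    then have "[m..<Suc n] = m # Suc m # [Suc (Suc m)..<Suc n]" "[Suc m..<Suc n] = Suc m # [Suc (Suc m)..<Suc n]"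
      by (simp_all add: upt_Cons_Suc del: upt_Suc)
    then have f: "f (map s [m..<Suc n]) = of_bool (P (s m) (s (Suc m))) + f (map s [Suc m..<Suc n])"
      by (simp only: list.map assms(3))
    have "{i. Suc m \<le> i \<and> i \<le> n \<and> P (s (i - 1)) (s i)} =
        (if P (s m) (s (Suc m)) then {Suc m} else {}) \<union> {i. Suc (Suc m) \<le> i \<and> i \<le> n \<and> P (s (i - 1)) (s i)}"
      (is "?A = ?B \<union> ?C")
    proof (rule set_eqI)
      fix i
      show "i \<in> ?A \<longleftrightarrow> i \<in> ?B \<union> ?C"
        using True by (cases "i = Suc m") auto
    qed
    moreover have "card (?B \<union> ?C) = card ?B + card ?C"
      by (rule card_Un_disjoint) auto
    ultimately have "card ?A = of_bool (P (s m) (s (Suc m))) + card ?C"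
      by (simp only:) simp
    with f step.IH show ?thesis
      by (simp only:)
  next
    case False
    then have "m = n" "{i. Suc m \<le> i \<and> i \<le> n \<and> P (s (i - 1)) (s i)} = {}"
      using step.hyps by auto
    then show ?thesis
      using assms(1) by (simp add: upt_Cons_Suc)
  qed
qed

text \<open>Serves 2-31 and 2-13 at once, which differ only in the direction of the adjacent
  pair.\<close>

lemma card_patterns:
  fixes P :: "nat \<Rightarrow> nat \<Rightarrow> nat \<Rightarrow> bool"
  assumes f: "\<And>v a. f v [a] = 0" "\<And>v. f v [] = 0" "\<And>v a b w. f v (a # b # w) = of_bool (P v a b) + f v (b # w)"
    and F: "F [] = 0" "\<And>a w. F (a # w) = f a w + F w"
  shows "F (word n s) = card {(i, j). 1 \<le> j \<and> j + 1 < i \<and> i \<le> n \<and> P (s j) (s (i - 1)) (s i)}"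
proof -
  have "F (map s [m..<Suc n]) = card {(i, j). m \<le> j \<and> j + 1 < i \<and> i \<le> n \<and> P (s j) (s (i - 1)) (s i)}"
    if "m \<le> Suc n" for m
    using that
  proof (induction m rule: inc_induct)
    case base
    have empty: "{(i, j). Suc n \<le> j \<and> j + 1 < i \<and> i \<le> n \<and> P (s j) (s (i - 1)) (s i)} = {}"
      by auto
    show ?case unfolding empty using F by simp
  next
    case (step m)
    have "f (s m) (map s [Suc m..<Suc n]) = card {i. Suc (Suc m) \<le> i \<and> i \<le> n \<and> P (s m) (s (i - 1)) (s i)}"
      using step.hyps by (intro card_steps f) auto
    also have "{i. Suc (Suc m) \<le> i \<and> i \<le> n \<and> P (s m) (s (i - 1)) (s i)} =
        {i. m + 1 < i \<and> i \<le> n \<and> P (s m) (s (i - 1)) (s i)}"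
      by auto
    finally have "F (map s [m..<Suc n]) =
        card {i. m + 1 < i \<and> i \<le> n \<and> P (s m) (s (i - 1)) (s i)} + F (map s [Suc m..<Suc n])"
      using step.hyps F(2) upt_Cons_Suc[of m n] by (simp del: upt_Suc)
    moreover have "card {(i, j). m \<le> j \<and> j + 1 < i \<and> i \<le> n \<and> P (s j) (s (i - 1)) (s i)} =
        card {i. m + 1 < i \<and> i \<le> n \<and> P (s m) (s (i - 1)) (s i)} +
        card {(i, j). Suc m \<le> j \<and> j + 1 < i \<and> i \<le> n \<and> P (s j) (s (i - 1)) (s i)}"
      by (rule card_pairs_snd_ge[of _ n]) simp
    ultimately show ?case
      using step.IH by (simp del: upt_Suc)
  qed
  from this[of 1] show ?thesis
    by (simp del: upt_Suc)
qed

lemma list_2_31_word: "list_2_31 (word n s) = pat2_31 n s"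
  unfolding pat2_31_def
  by (rule card_patterns[where f = descents_across and P = "\<lambda>v a b. a > v \<and> v > b"])
    (simp_all only: descents_across.simps list_2_31.simps conj_commute)

lemma list_2_13_word: "list_2_13 (word n s) = pat2_13 n s"
  unfolding pat2_13_def
  by (rule card_patterns[where f = ascents_across and P = "\<lambda>v a b. a < v \<and> v < b"]) simp_all

text \<open>At \<open>m = 0\<close> no value is left for an open place. \<open>delta 0\<close>
  discards the words with zeros, and the others use every column, so that no advance charge
  remains.\<close>

lemma sum_perms:
  fixes x y q :: "'a::comm_ring_1"
  shows "(\<Sum>s\<in>perms n. x ^ exc n s * y ^ card {i \<in> {1..n}. s i = i} * q ^ invc n s) =
    (tridiag (\<lambda>h. q ^ (2 * h + 1)) (\<lambda>h. y * q ^ (2 * h) + (x + 1) * (q ^ h * qint q h))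
      (\<lambda>h. x * (qint q h)\<^sup>2) ^^ n) (delta 0) 0"
proof -
  let ?W = "{w. set w = {1..n} \<and> distinct w}"
  have full: "placements n 0 \<inter> {w. zeros w = 0} = ?W"
  proof (intro set_eqI iffI)
    fix w assume w: "w \<in> placements n 0 \<inter> {w. zeros w = 0}"
    then have "0 \<notin> set w"
      by (simp add: zeros_def count_list_0_iff)
    then have "filter (\<lambda>x. x \<noteq> 0) w = w"
      by (metis (mono_tags, lifting) filter_True)
    with w \<open>0 \<notin> set w\<close> have "distinct w" "set w \<subseteq> {1..n}" "length w = n"
      by (auto simp: placements_def)
    then show "w \<in> ?W"
      using card_subset_eq[of "{1..n}" "set w"] distinct_card[of w] by simp
  next
    fix w assume w: "w \<in> ?W"
    then have "length w = n"
      using distinct_card[of w] by simp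
    with w show "w \<in> placements n 0 \<inter> {w. zeros w = 0}"
      by (auto simp: placements_def zeros_def count_list_0_iff)
  qed
  have "(tridiag (\<lambda>h. q ^ (2 * h + 1)) (\<lambda>h. y * q ^ (2 * h) + (x + 1) * (q ^ h * qint q h))
      (\<lambda>h. x * (qint q h)\<^sup>2) ^^ n) (delta 0) 0 =
      (\<Sum>w\<in>placements n 0. placement_weight n x y q 0 w * of_bool (zeros w = 0))"
    using sum_placement_weight[of n n x y q "delta 0"] by simp
  also have "\<dots> = (\<Sum>w\<in>?W. placement_weight n x y q 0 w)"
    unfolding full[symmetric] by (rule sum_mult_of_bool_eq) simp
  also have "\<dots> = (\<Sum>w\<in>?W. rook_weight n x y w * q ^ inv_list w)"
    by (intro sum.cong) (auto simp: placement_weight_def open_cols_def)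
  also have "\<dots> = (\<Sum>s\<in>perms n. rook_weight n x y (word n s) * q ^ inv_list (word n s))"
    by (rule sum.reindex_bij_betw[OF bij_betw_word, symmetric])
  also have "\<dots> = (\<Sum>s\<in>perms n. x ^ exc n s * y ^ card {i \<in> {1..n}. s i = i} * q ^ invc n s)"
    unfolding rook_weight_word inv_list_word ..
  finally show ?thesis ..
qed

text \<open>With \<open>y = 0\<close> the power \<open>0 ^ card ...\<close> is the indicator of
  having no fixed point.\<close>

lemma sum_derangements:
  fixes x q :: "'a::comm_ring_1"
  shows "(\<Sum>s\<in>derangements n. x ^ exc n s * q ^ invc n s) =
    (tridiag (\<lambda>h. q ^ (2 * h + 1)) (\<lambda>h. (x + 1) * (q ^ h * qint q h))
      (\<lambda>h. x * (qint q h)\<^sup>2) ^^ n) (delta 0) 0"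
proof -
  have fin: "finite (perms n)"
    by (simp add: perms_def finite_permutations)
  have "(\<Sum>s\<in>derangements n. x ^ exc n s * q ^ invc n s) =
      (\<Sum>s\<in>perms n. x ^ exc n s * 0 ^ card {i \<in> {1..n}. s i = i} * q ^ invc n s)"
  proof (rule sum.mono_neutral_cong_left[OF fin])
    fix s assume "s \<in> derangements n"
    then have none: "{i \<in> {1..n}. s i = i} = {}"
      by (auto simp: derangements_def)
    show "x ^ exc n s * q ^ invc n s = x ^ exc n s * 0 ^ card {i \<in> {1..n}. s i = i} * q ^ invc n s"
      unfolding none by simp
  next
    show "\<forall>s\<in>perms n - derangements n. x ^ exc n s * 0 ^ card {i \<in> {1..n}. s i = i} * q ^ invc n s = 0"
    proof
      fix s assume "s \<in> perms n - derangements n"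
      then have "{i \<in> {1..n}. s i = i} \<noteq> {}"
        by (auto simp: derangements_def)
      then have "card {i \<in> {1..n}. s i = i} > 0"
        by (simp add: card_gt_0_iff)
      then show "x ^ exc n s * 0 ^ card {i \<in> {1..n}. s i = i} * q ^ invc n s = 0"
        by (simp add: zero_power)
    qed
  qed (simp add: derangements_def)
  then show ?thesis
    using sum_perms[where y = 0 and x = x and q = q and n = n] by simp
qed

section \<open>Alternating permutations as words between zeros\<close>

lemma rising_alt_conv_nth:
  "rising_alt v \<longleftrightarrow> odd (length v) \<and>
    (\<forall>i. Suc i < length v \<longrightarrow> (if even i then v ! i < v ! Suc i else v ! Suc i < v ! i))"
proof (induction v rule: rising_alt.induct)
  case (3 a b w)
  have split: "(\<forall>i. P i) \<longleftrightarrow> P 0 \<and> P (Suc 0) \<and> (\<forall>i. P (Suc (Suc i)))" for P :: "nat \<Rightarrow> bool"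
    by (metis nat.exhaust)
  show ?case
  proof (cases "w = []")
    case False
    then show ?thesis
      unfolding rising_alt.simps 3 by (subst (2) split) (auto simp: hd_conv_nth)
  qed simp
qed auto

lemma word_nth:
  "i \<le> n \<Longrightarrow> (0 # word n s) ! i = (if i = 0 then 0 else s i)"
  "i \<le> Suc n \<Longrightarrow> (0 # word n s @ [0]) ! i = (if i = 0 \<or> i = Suc n then 0 else s i)"
  by (cases i; simp add: nth_append del: upt_Suc)+

text \<open>The leading 0 makes the first letter a peak and the index in the list equal to the index
  in \<open>s\<close>. For odd \<open>n\<close> the last letter is a peak too and needs a closing
  0.\<close>

lemma falt_iff_rising_alt:
  assumes s: "s \<in> perms n"
  shows "even n \<Longrightarrow> s \<in> falt n \<longleftrightarrow> rising_alt (0 # word n s)"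
    and "odd n \<Longrightarrow> s \<in> falt n \<longleftrightarrow> rising_alt (0 # word n s @ [0])"
proof -
  have pos: "0 < s i" if "i \<in> {1..n}" for i
    using s that permutes_in_image[of s "{1..n}" i] by (auto simp: perms_def)
  let ?step = "\<lambda>i. if even i then s i < s (Suc i) else s (Suc i) < s i"
  have falt: "s \<in> falt n \<longleftrightarrow> (\<forall>i. 1 \<le> i \<and> i < n \<longrightarrow> ?step i)"
    using s by (auto simp: falt_def)
  show "s \<in> falt n \<longleftrightarrow> rising_alt (0 # word n s)" if "even n"
  proof -
    let ?v = "0 # word n s"
    have "(if even i then ?v ! i < ?v ! Suc i else ?v ! Suc i < ?v ! i) \<longleftrightarrow> (1 \<le> i \<longrightarrow> ?step i)"
      if "i < n" for i
      using that pos[of 1] by (simp add: word_nth del: upt_Suc nth_Cons_Suc)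
    then show ?thesis
      using that unfolding falt rising_alt_conv_nth by (auto simp del: upt_Suc nth_Cons_Suc)
  qed
  show "s \<in> falt n \<longleftrightarrow> rising_alt (0 # word n s @ [0])" if "odd n"
  proof -
    let ?v = "0 # word n s @ [0]"
    have "(if even i then ?v ! i < ?v ! Suc i else ?v ! Suc i < ?v ! i) \<longleftrightarrow> (1 \<le> i \<and> i < n \<longrightarrow> ?step i)"
      if "i < Suc n" for i
    proof (cases "i = n")
      case True
      then show ?thesis
        using \<open>odd n\<close> odd_pos[of n] pos[of n] by (simp add: word_nth del: upt_Suc nth_Cons_Suc nth_Cons_pos)
    next
      case False
      then have "i < n"
        using that by simp
      then show ?thesis
        using pos[of 1] by (simp add: word_nth del: upt_Suc nth_Cons_Suc nth_Cons_pos)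
    qed
    then show ?thesis
      using that unfolding falt rising_alt_conv_nth by (auto simp del: upt_Suc nth_Cons_Suc)
  qed
qed

lemma set_word: "s \<in> perms n \<Longrightarrow> set (word n s) = {1..n}"
  and distinct_word: "s \<in> perms n \<Longrightarrow> distinct (word n s)"
  using bij_betwE[OF bij_betw_word] by (auto simp del: upt_Suc set_map)

lemma inj_on_word: "inj_on (word n) (perms n)"
  using bij_betw_word by (simp add: bij_betw_def del: upt_Suc)

lemma obtain_word:
  assumes "set w = {1..n}" "distinct w"
  obtains s where "s \<in> perms n" "w = word n s"
proof -
  have "w \<in> word n ` perms n"
    unfolding bij_betw_imp_surj_on[OF bij_betw_word] using assms by simp
  then show ?thesis
    using that by blast
qed

lemma alt_words_even:
  assumes "even n"
  shows "alt_words False n 0 \<inter> {v. zeros (tl v) = 0} = (\<lambda>s. 0 # word n s) ` falt n"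
proof (intro set_eqI iffI)
  fix v assume "v \<in> alt_words False n 0 \<inter> {v. zeros (tl v) = 0}"
  then have v: "v \<in> alt_words False n 0" and z: "zeros (tl v) = 0"
    by auto
  obtain w where vw: "v = 0 # w"
    using alt_wordsD(1,2)[OF v] by (cases v) auto
  have w0: "0 \<notin> set w"
    using z vw by (simp add: zeros_def count_list_0_iff)
  have "set v = insert 0 {1..n}"
    using alt_wordsD(3)[OF v] by simp
  moreover have "set w = set v - {0}"
    using w0 vw by auto
  ultimately have "set w = {1..n}"
    by auto
  moreover have "filter (\<lambda>x. x \<noteq> 0) w = w"
    using w0 by (intro filter_True) metis
  then have "distinct w"
    using alt_wordsD(4)[OF v] vw by simp
  ultimately obtain s where s: "s \<in> perms n" "w = word n s"
    by (rule obtain_word)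
  then show "v \<in> (\<lambda>s. 0 # word n s) ` falt n"
    using falt_iff_rising_alt(1)[OF s(1) assms] alt_wordsD(2)[OF v] vw by (auto simp del: upt_Suc)
next
  fix v assume "v \<in> (\<lambda>s. 0 # word n s) ` falt n"
  then obtain s where s: "s \<in> falt n" and v: "v = 0 # word n s"
    by blast
  then have p: "s \<in> perms n"
    by (simp add: falt_def)
  have "v \<in> alt_words False n 0"
  proof (rule alt_wordsI)
    show "rising_alt v"
      using falt_iff_rising_alt(1)[OF p assms] s v by simp
  qed (use set_word[OF p] distinct_word[OF p] v in \<open>auto simp del: upt_Suc set_map\<close>)
  moreover have "0 \<notin> set (word n s)"
    unfolding set_word[OF p] by simp
  ultimately show "v \<in> alt_words False n 0 \<inter> {v. zeros (tl v) = 0}"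
    using v by (simp add: zeros_def count_list_0_iff del: upt_Suc set_map)
qed

text \<open>The closing 0 is counted by \<open>zeros (tl v)\<close>, so the final state is 1 and not
  0.\<close>

lemma alt_words_odd:
  assumes "odd n"
  shows "alt_words True n 0 \<inter> {v. zeros (tl v) = 1} = (\<lambda>s. 0 # word n s @ [0]) ` falt n"
proof (intro set_eqI iffI)
  fix v assume "v \<in> alt_words True n 0 \<inter> {v. zeros (tl v) = 1}"
  then have v: "v \<in> alt_words True n 0" and z: "zeros (tl v) = 1"
    by auto
  obtain w' where vw': "v = 0 # w'"
    using alt_wordsD(1,2)[OF v] by (cases v) auto
  then have "w' \<noteq> []"
    using z by auto
  then have "last w' = 0"
    using alt_wordsD(5)[OF v] vw' by simp
  then obtain w where vw: "v = 0 # w @ [0]"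
    using vw' \<open>w' \<noteq> []\<close> by (metis append_butlast_last_id)
  have w0: "0 \<notin> set w"
    using z vw by (simp add: zeros_def count_list_0_iff)
  have "set v = insert 0 {1..n}"
    using alt_wordsD(3)[OF v] by simp
  moreover have "set w = set v - {0}"
    using w0 vw by auto
  ultimately have "set w = {1..n}"
    by auto
  moreover have "filter (\<lambda>x. x \<noteq> 0) w = w"
    using w0 by (intro filter_True) metis
  then have "distinct w"
    using alt_wordsD(4)[OF v] vw by simp
  ultimately obtain s where s: "s \<in> perms n" "w = word n s"
    by (rule obtain_word)
  then show "v \<in> (\<lambda>s. 0 # word n s @ [0]) ` falt n"
    using falt_iff_rising_alt(2)[OF s(1) assms] alt_wordsD(2)[OF v] vw by (auto simp del: upt_Suc)
next
  fix v assume "v \<in> (\<lambda>s. 0 # word n s @ [0]) ` falt n"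
  then obtain s where s: "s \<in> falt n" and v: "v = 0 # word n s @ [0]"
    by blast
  then have p: "s \<in> perms n"
    by (simp add: falt_def)
  have "v \<in> alt_words True n 0"
  proof (rule alt_wordsI)
    show "rising_alt v"
      using falt_iff_rising_alt(2)[OF p assms] s v by simp
  qed (use set_word[OF p] distinct_word[OF p] v in \<open>auto simp del: upt_Suc set_map\<close>)
  moreover have "0 \<notin> set (word n s)"
    unfolding set_word[OF p] by simp
  ultimately show "v \<in> alt_words True n 0 \<inter> {v. zeros (tl v) = 1}"
    using v by (simp add: zeros_def count_list_0_iff del: upt_Suc set_map)
qed

section \<open>Exchanging 2-31 for 2-13\<close>

lemma list_31_2_snoc_0: "list_31_2 (w @ [0]) = list_31_2 w"
  by (induction w rule: list_31_2.induct) auto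

lemma list_31_2_Cons_0: "list_31_2 (0 # w) = list_31_2 w"
  by (cases w) auto

lemma list_2_13_snoc_0: "list_2_13 (w @ [0]) = list_2_13 w"
proof (induction w)
  case (Cons a w)
  have "ascents_across v (u @ [0]) = ascents_across v u" for v u
    by (induction v u rule: ascents_across.induct) auto
  with Cons show ?case by simp
qed simp

text \<open>Down- and up-crossings of the level \<open>v\<close> alternate, so their difference
  depends only on the two ends.\<close>

lemma crossing_balance:
  "v \<notin> set w \<Longrightarrow> w \<noteq> [] \<Longrightarrow>
    descents_across v w + of_bool (v < last w) = ascents_across v w + of_bool (v < hd w)"
  by (induction v w rule: descents_across.induct) auto

text \<open>After a valley the word starts above it and ends below it at 0, which gives one surplus
  descent; after a peak it starts and ends below. There are \<open>length v div 2\<close> valleys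
  besides the final 0.\<close>

lemma list_2_31_eq_2_13:
  assumes "rising_alt v" "distinct v" "last v = 0"
  shows "list_2_31 v = list_2_13 v + length v div 2"
  using assms
proof (induction v rule: rising_alt.induct)
  case (3 a b t)
  then have t: "t \<noteq> []" "a \<notin> set (b # t)" "b \<notin> set t" "hd t < b" "a < b"
    by auto
  then have last: "last t = 0"
    using 3 by simp
  with t have "0 < a"
    using last_in_set[of t] by (cases a) auto
  then have "descents_across a (b # t) = Suc (ascents_across a (b # t))"
    and "descents_across b t = ascents_across b t"
    using t last crossing_balance[of a "b # t"] crossing_balance[of b t] by auto
  with 3 t last show ?case by simp
qed auto

lemma sum_falt_even:
  fixes p q :: "'a::comm_ring_1"
  assumes "even n"
  shows "(\<Sum>s\<in>falt n. q ^ pat31_2 n s * p ^ pat2_31 n s) = (alt_step False p q ^^ n) (delta 0) 0"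
proof -
  have inj: "inj_on (\<lambda>s. 0 # word n s) (falt n)"
    using inj_on_word[of n] by (auto simp: inj_on_def falt_def simp del: upt_Suc)
  have "(alt_step False p q ^^ n) (delta 0) 0 =
      (\<Sum>v\<in>alt_words False n 0. alt_weight p q v * of_bool (zeros (tl v) = 0))"
    using sum_alt_weight[of n n p q "delta 0" False] by simp
  also have "\<dots> = (\<Sum>v\<in>(\<lambda>s. 0 # word n s) ` falt n. alt_weight p q v)"
    unfolding alt_words_even[OF assms, symmetric] by (rule sum_mult_of_bool_eq) simp
  also have "\<dots> = (\<Sum>s\<in>falt n. q ^ pat31_2 n s * p ^ pat2_31 n s)"
    by (subst sum.reindex[OF inj])
      (simp add: alt_weight_def list_31_2_Cons_0 list_31_2_word list_2_31_word del: upt_Suc)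
  finally show ?thesis ..
qed

text \<open>The shift by \<open>n div 2\<close> stands as a factor on the left, as \<open>p\<close>
  need not be invertible.\<close>

lemma sum_falt_odd:
  fixes p q :: "'a::comm_ring_1"
  assumes "odd n"
  shows "p ^ (n div 2) * (\<Sum>s\<in>falt n. q ^ pat31_2 n s * p ^ pat2_13 n s) =
    (alt_step True p q ^^ n) (delta 1) 0"
proof -
  have inj: "inj_on (\<lambda>s. 0 # word n s @ [0]) (falt n)"
    using inj_on_word[of n] by (auto simp: inj_on_def falt_def simp del: upt_Suc)
  have weight: "alt_weight p q (0 # word n s @ [0]) = p ^ (n div 2) * (q ^ pat31_2 n s * p ^ pat2_13 n s)"
    if "s \<in> falt n" for s
  proof -
    have s: "s \<in> perms n"
      using that by (simp add: falt_def)
    obtain b w where w: "word n s = b # w"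
      using assms by (cases "word n s") (auto elim: oddE simp del: upt_Suc)
    have len: "length (w @ [0]) = n"
      using arg_cong[OF w, of length] by (simp del: upt_Suc)
    have alt: "rising_alt (0 # b # w @ [0])"
      using falt_iff_rising_alt(2)[OF s assms] that w by simp
    then have hd: "hd (w @ [0]) < b" and alt': "rising_alt (w @ [0])"
      by simp_all
    have "0 \<notin> set (b # w)"
      unfolding w[symmetric] set_word[OF s] by simp
    \<comment> \<open>Only one 0 may occur here, so the leading 0 and the first peak
      \<open>b\<close> are treated apart; neither adds to the shift.\<close>
    then have d: "distinct (b # w @ [0])"
      using distinct_word[OF s] unfolding w by auto
    have "descents_across b (w @ [0]) = ascents_across b (w @ [0])"
      using crossing_balance[of b "w @ [0]"] d hd by auto
    then have "list_2_31 (0 # word n s @ [0]) = list_2_13 (word n s @ [0]) + n div 2"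
      using list_2_31_eq_2_13[OF alt'] d len unfolding w by simp
    then show ?thesis
      unfolding list_2_13_snoc_0 list_2_13_word alt_weight_def list_31_2_Cons_0 list_31_2_snoc_0 list_31_2_word
      by (simp add: power_add mult_ac)
  qed
  have "(alt_step True p q ^^ n) (delta 1) 0 =
      (\<Sum>v\<in>alt_words True n 0. alt_weight p q v * of_bool (zeros (tl v) = 1))"
    using sum_alt_weight[of n n p q "delta 1" True] by simp
  also have "\<dots> = (\<Sum>v\<in>(\<lambda>s. 0 # word n s @ [0]) ` falt n. alt_weight p q v)"
    unfolding alt_words_odd[OF assms, symmetric] by (rule sum_mult_of_bool_eq) simp
  also have "\<dots> = (\<Sum>s\<in>falt n. alt_weight p q (0 # word n s @ [0]))"
    by (subst sum.reindex[OF inj]) simp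
  also have "\<dots> = p ^ (n div 2) * (\<Sum>s\<in>falt n. q ^ pat31_2 n s * p ^ pat2_13 n s)"
    unfolding sum_distrib_left by (intro sum.cong refl weight)
  finally show ?thesis ..
qed

section \<open>Comparison of the operators\<close>

text \<open>State 1 cannot be left downwards, so the states from 1 on form a system of their own.
  This is the case of a kept right end.\<close>

lemma tridiag_shift:
  fixes u d :: "nat \<Rightarrow> 'a::comm_ring_1"
  assumes "d (Suc 0) = 0"
  shows "(tridiag u (\<lambda>_. 0) d ^^ n) (delta (Suc 0)) (Suc h) =
    (tridiag (\<lambda>h. u (Suc h)) (\<lambda>_. 0) (\<lambda>h. d (Suc h)) ^^ n) (delta 0) h"
proof (induction n arbitrary: h)
  case (Suc n)
  show ?case
    unfolding funpow_tridiag using assms Suc by (cases h) simp_all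
qed simp

lemma falt_power_sum:
  "(\<Sum>s\<in>falt n. q ^ a s * (q\<^sup>2) ^ b s) = (\<Sum>s\<in>falt n. q ^ (a s + 2 * b s) :: 'a::comm_ring_1)"
  by (simp add: power_add power_mult)

lemma derangement_sum:
  fixes q :: "'a::field"
  assumes q: "q \<noteq> 0"
  shows "(\<Sum>s\<in>derangements n. (- 1) ^ exc n s * q ^ invc n s) =
    (if even n then (- q) ^ (n div 2) * (\<Sum>s\<in>falt n. q ^ (pat31_2 n s + 2 * pat2_31 n s)) else 0)"
proof -
  let ?X = "tridiag (\<lambda>h. q ^ (2 * h + 1)) (\<lambda>_. 0) (\<lambda>h. - 1 * (qint q h)\<^sup>2)"
  have X: "(\<Sum>s\<in>derangements n. (- 1) ^ exc n s * q ^ invc n s) = (?X ^^ n) (delta 0) 0"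
    using sum_derangements[of "- 1" n q] by simp
  show ?thesis
  proof (cases "even n")
    case True
    \<comment> \<open>The factor is \<open>c (Suc h) / c h\<close> as dictated by
      \<open>down\<close>; \<open>up\<close> then forces \<open>r = - q\<close>. Only
      \<open>c 0 = 1\<close> enters the result, so zeros of \<open>c\<close> at roots of unity do no
      harm.\<close>
    define c where "c h = (\<Prod>i<h. - qint q (Suc i) / q ^ i)" for h
    have "(- q) ^ 0 * (?X ^^ n) (delta 0) 0 =
        (- q) ^ ((n + 0) div 2) * c 0 * (alt_step False (q\<^sup>2) q ^^ n) (delta 0) 0"
      unfolding alt_step_def if_False
    proof (rule tridiag_gauge)
      fix h
      show "q ^ (2 * h + 1) * c (Suc h) = - q * c h * pqint (q\<^sup>2) q (Suc h)"
        unfolding pqint_square using q by (simp add: c_def power_add mult_2 mult_2_right field_simps)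
      show "- 1 * (qint q (Suc h))\<^sup>2 * c h = c (Suc h) * pqint (q\<^sup>2) q (Suc h)"
        unfolding pqint_square using q by (simp add: c_def power2_eq_square field_simps)
    qed (use q True in \<open>simp_all add: c_def\<close>)
    then show ?thesis
      unfolding X sum_falt_even[OF True, symmetric] falt_power_sum using True by (simp add: c_def)
  next
    case False
    then show ?thesis
      unfolding X by (simp add: tridiag_parity)
  qed
qed

lemma permutation_sum:
  fixes q :: "'a::field"
  assumes q: "q \<noteq> 0" and "n \<ge> 1"
  shows "(\<Sum>s\<in>perms n. (- 1 / q) ^ exc n s * q ^ invc n s) =
    (if even n then 0
     else (- 1) ^ ((n - 1) div 2) * (\<Sum>s\<in>falt n. q ^ (pat31_2 n s + 2 * pat2_13 n s)))"
proof -
  obtain m where n: "n = Suc m"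
    using assms(2) by (cases n) auto
  let ?T = "tridiag (\<lambda>h. q ^ (2 * h + 1)) (\<lambda>h. 1 * q ^ (2 * h) + (- 1 / q + 1) * (q ^ h * qint q h))
      (\<lambda>h. - 1 / q * (qint q h)\<^sup>2)"
  \<comment> \<open>The other factor, which stays implicit, sends \<open>g\<close> to
    \<open>q^(h+1) g(h+1) + [h+1] g(h)\<close>. Applied after \<open>?P\<close>, its diagonal
    \<open>q^h [h+1] - q^(h+1) [h+1] / q\<close> cancels, and \<open>?K\<close> is what
    remains.\<close>
  let ?P = "tridiag (\<lambda>_. 0) (\<lambda>h. q ^ h) (\<lambda>h. - qint q h / q)"
  let ?K = "tridiag (\<lambda>h. q ^ (2 * h + 2)) (\<lambda>_. 0) (\<lambda>h. - (qint q h * qint q (Suc h)) / q)"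
  have T: "(\<Sum>s\<in>perms n. (- 1 / q) ^ exc n s * q ^ invc n s) = (?T ^^ n) (delta 0) 0"
    using sum_perms[of "- 1 / q" n 1 q] by simp
  have commute: "?T (?P k) = ?P (?K k)" for k
  proof
    fix h
    show "?T (?P k) h = ?P (?K k) h"
    proof (cases h)
      case 0
      then show ?thesis
        using q by (simp add: tridiag_def qint_Suc field_simps power2_eq_square)
    next
      case (Suc j)
      \<comment> \<open>Eliminating \<open>q ^ j\<close> leaves a rational identity in
        \<open>q\<close> and \<open>qint q j\<close>.\<close>
      have Q: "q ^ j = 1 + qint q j * (q - 1)"
        by (rule qint_geometric)
      show ?thesis
        using q unfolding Suc tridiag_def
        by (simp add: qint_Suc power_add power_mult power_mult_distrib mult_2 power2_eq_square)
          (simp add: Q field_simps)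
    qed
  qed
  \<comment> \<open>The implicit right factor fixes \<open>delta 0\<close>.\<close>
  have "?T (delta 0) = ?P (delta 0)"
  proof
    fix h
    show "?T (delta 0) h = ?P (delta 0) h"
    proof (cases h)
      case (Suc j)
      then show ?thesis
        by (cases j) (simp_all add: tridiag_def qint_Suc)
    qed (simp add: tridiag_def)
  qed
  then have "(?T ^^ Suc k) (delta 0) = ?P ((?K ^^ k) (delta 0))" for k
    by (induction k) (simp_all only: funpow.simps o_apply id_apply commute)
  \<comment> \<open>At state 0 the factor \<open>?P\<close> acts as the identity, since
    \<open>q ^ 0 = 1\<close> and \<open>qint q 0 = 0\<close>.\<close>
  then have K: "(?T ^^ n) (delta 0) 0 = (?K ^^ m) (delta 0) 0"
    unfolding n by (simp add: tridiag_def[of "\<lambda>_. 0"])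
  show ?thesis
  proof (cases "even n")
    case True
    then show ?thesis
      unfolding T K using n by (simp add: tridiag_parity)
  next
    case False
    let ?Y = "tridiag (\<lambda>h. pqint (q\<^sup>2) q (Suc (Suc h))) (\<lambda>_. 0) (\<lambda>h. q\<^sup>2 * pqint (q\<^sup>2) q (Suc h - 1))"
    let ?S = "\<Sum>s\<in>falt n. q ^ (pat31_2 n s + 2 * pat2_13 n s)"
    have m: "even m" "n div 2 = m div 2" "(n - 1) div 2 = m div 2"
      using False n by auto
    have "(q\<^sup>2) ^ (n div 2) * ?S = (alt_step True (q\<^sup>2) q ^^ n) (delta 1) 0"
      using sum_falt_odd[OF False, of "q\<^sup>2" q] unfolding falt_power_sum .
    \<comment> \<open>From state 0 the only move leads to 1, with weight
      \<open>pqint p q 1 = 1\<close>.\<close>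
    also have "\<dots> = (alt_step True (q\<^sup>2) q ^^ m) (delta (Suc 0)) (Suc 0)"
      unfolding n alt_step_def funpow_tridiag by (simp add: pqint_Suc)
    also have "\<dots> = (?Y ^^ m) (delta 0) 0"
      unfolding alt_step_def if_True by (subst tridiag_shift) simp_all
    finally have Y: "(?Y ^^ m) (delta 0) 0 = (q\<^sup>2) ^ (m div 2) * ?S"
      unfolding m by simp
    \<comment> \<open>Again \<open>down\<close> dictates the factor, and \<open>up\<close> forces
      \<open>r = - 1 / q^2\<close>.\<close>
    define c where "c h = (\<Prod>i<h. - qint q (Suc (Suc i)) / q ^ (i + 3))" for h
    have "(- 1 / q\<^sup>2) ^ 0 * (?K ^^ m) (delta 0) 0 =
        (- 1 / q\<^sup>2) ^ ((m + 0) div 2) * c 0 * (?Y ^^ m) (delta 0) 0"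
    proof (rule tridiag_gauge)
      fix h
      show "q ^ (2 * h + 2) * c (Suc h) = - 1 / q\<^sup>2 * c h * pqint (q\<^sup>2) q (Suc (Suc h))"
        unfolding pqint_square using q by (simp add: c_def power_add mult_2 mult_2_right field_simps power2_eq_square power3_eq_cube)
      show "- (qint q (Suc h) * qint q (Suc (Suc h))) / q * c h =
          c (Suc h) * (q\<^sup>2 * pqint (q\<^sup>2) q (Suc (Suc h) - 1))"
        unfolding diff_Suc_1 pqint_square using q by (simp add: c_def power_add field_simps power2_eq_square power3_eq_cube)
    qed (use q m in \<open>simp_all add: c_def\<close>)
    \<comment> \<open>The powers of \<open>q^2\<close> from the comparison and from the exchange of
      patterns cancel, leaving the sign.\<close>
    also have "\<dots> = (- 1 / q\<^sup>2 * q\<^sup>2) ^ (m div 2) * ?S"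
      unfolding Y power_mult_distrib by (simp add: c_def)
    also have "- 1 / q\<^sup>2 * q\<^sup>2 = - 1"
      using q by simp
    finally show ?thesis
      unfolding T K m using False by simp
  qed
qed

theorem theorem1p3:
  fixes q :: "'a::field" and n :: nat
  assumes "n \<ge> 1" and "q \<noteq> 0"
  shows "((\<Sum>s\<in>perms n. (- 1 / q) ^ exc n s * q ^ invc n s) =
           (if even n then 0
            else (- 1) ^ ((n - 1) div 2) * (\<Sum>s\<in>falt n. q ^ (pat31_2 n s + 2 * pat2_13 n s)))) \<and>
         ((\<Sum>s\<in>derangements n. (- 1) ^ exc n s * q ^ invc n s) =
           (if even n then (- q) ^ (n div 2) * (\<Sum>s\<in>falt n. q ^ (pat31_2 n s + 2 * pat2_31 n s))
            else 0))"
  using permutation_sum[OF assms(2,1)] derangement_sum[OF assms(2)] by (rule conjI)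

end
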